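(* Let $(G,\cdot)$ be a finite solvable group that is not a Dedekind group. Then the identities of the involution semigroup $(\mathcal{P}(G),\cdot,{}^{-1})$ (considered as an algebra of type $(2,1)$) admit no finite basis.
   Context: An involution semigroup is an algebra $(S,\cdot,{}^* )$ of type $(2,1)$ whose binary operation is associative and whose unary operation satisfies $(xy)^*=y^*x^*$ and $(x^* )^*=x$. A group is Dedekind if all of its subgroups are normal. For a group $(G,\cdot)$, $\mathcal{P}(G)$ denotes the set of all subsets of $G$ (including the empty set), with element-wise multiplication $A\cdot B:=\{ab\mid a\in A,\ b\in B\}$ and element-wise inversion $A^{-1}:=\{g^{-1}\mid g\in A\}$; then $(\mathcal{P}(G),\cdot,{}^{-1})$ is an involution semigroup. A basis for the identities of an algebra $\mathcal{A}$ is a set $\Sigma$ of identities holding in $\mathcal{A}$ (in the signature of $\mathcal{A}$) such that every algebra of the same type satisfying $\Sigma$ satisfies all identities of $\mathcal{A}$. The identities of $\mathcal{A}$ admit a finite basis if there is a finite such $\Sigma$. *)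

theory Defs
  imports "HOL-Algebra.Solvable_Groups" "HOL-Library.Countable_Set"
begin

section \<open>Algebras of type (2,1), terms and identities\<close>

record 'a alg21 = "'a partial_object" +
  mul :: "'a \<Rightarrow> 'a \<Rightarrow> 'a"
  star :: "'a \<Rightarrow> 'a"

definition algebra21 :: "'a alg21 \<Rightarrow> bool" where
  "algebra21 A \<longleftrightarrow> carrier A \<noteq> {} \<and>
     (\<forall>x\<in>carrier A. \<forall>y\<in>carrier A. mul A x y \<in> carrier A) \<and>
     (\<forall>x\<in>carrier A. star A x \<in> carrier A)"

definition involution_semigroup :: "'a alg21 \<Rightarrow> bool" where
  "involution_semigroup A \<longleftrightarrow> algebra21 A \<and>
     (\<forall>x\<in>carrier A. \<forall>y\<in>carrier A. \<forall>z\<in>carrier A.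
        mul A (mul A x y) z = mul A x (mul A y z)) \<and>
     (\<forall>x\<in>carrier A. \<forall>y\<in>carrier A. star A (mul A x y) = mul A (star A y) (star A x)) \<and>
     (\<forall>x\<in>carrier A. star A (star A x) = x)"

text \<open>Terms are the absolutely free ones, not words modulo associativity or the involution laws:
  an identity is a pair of terms in the bare signature.\<close>

datatype term21 = Var nat | Mul term21 term21 | Star term21

type_synonym identity21 = "term21 \<times> term21"

primrec eval21 :: "'a alg21 \<Rightarrow> (nat \<Rightarrow> 'a) \<Rightarrow> term21 \<Rightarrow> 'a" where
  "eval21 A v (Var i) = v i"
| "eval21 A v (Mul s t) = mul A (eval21 A v s) (eval21 A v t)"
| "eval21 A v (Star t) = star A (eval21 A v t)"

definition satisfies :: "'a alg21 \<Rightarrow> identity21 \<Rightarrow> bool" where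
  "satisfies A e \<longleftrightarrow>
     (\<forall>v. range v \<subseteq> carrier A \<longrightarrow> eval21 A v (fst e) = eval21 A v (snd e))"

definition identities :: "'a alg21 \<Rightarrow> identity21 set" where
  "identities A = {e. satisfies A e}"

section \<open>Bases of identities\<close>

text \<open>HOL cannot quantify over all types inside a formula, so ``every algebra'' is first
  relativised to the algebras whose carrier is a subset of a given type \<open>'b\<close>.\<close>

definition identity_basis_over :: "'b itself \<Rightarrow> 'a alg21 \<Rightarrow> identity21 set \<Rightarrow> bool" where
  "identity_basis_over TYPE('b) A \<Sigma> \<longleftrightarrow> \<Sigma> \<subseteq> identities A \<and>
     (\<forall>B :: 'b alg21. algebra21 B \<longrightarrow> (\<forall>e\<in>\<Sigma>. satisfies B e) \<longrightarrow> (\<forall>e\<in>identities A. satisfies B e))"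

text \<open>Algebras with carrier in \<^typ>\<open>nat\<close> suffice: the lemma \<open>identity_basis_imp\<close> below shows that
  the condition then holds for the algebras over every type.\<close>

definition identity_basis :: "'a alg21 \<Rightarrow> identity21 set \<Rightarrow> bool" where
  "identity_basis A \<Sigma> \<longleftrightarrow> identity_basis_over TYPE(nat) A \<Sigma>"

definition finitely_based :: "'a alg21 \<Rightarrow> bool" where
  "finitely_based A \<longleftrightarrow> (\<exists>\<Sigma>. finite \<Sigma> \<and> identity_basis A \<Sigma>)"

instance term21 :: countable
  by countable_datatype

lemma eval21_closed:
  assumes "algebra21 A" "range v \<subseteq> carrier A"
  shows "eval21 A v t \<in> carrier A"
  using assms by (induction t) (auto simp: algebra21_def)

lemma identity_basis_over_transfer:
  fixes A :: "'a alg21"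
  assumes inf: "infinite (UNIV :: 'b set)"
    and basis: "identity_basis_over TYPE('b) A \<Sigma>"
  shows "identity_basis_over TYPE('c) A \<Sigma>"
  unfolding identity_basis_over_def
proof (intro conjI allI impI ballI)
  show "\<Sigma> \<subseteq> identities A"
    using basis by (simp add: identity_basis_over_def)
next
  fix B :: "'c alg21" and e
  assume B: "algebra21 B" and sat: "\<forall>e\<in>\<Sigma>. satisfies B e" and e: "e \<in> identities A"
  show "satisfies B e"
    unfolding satisfies_def
  proof (intro allI impI)
    fix v :: "nat \<Rightarrow> 'c"
    assume v: "range v \<subseteq> carrier B"
    define C where "C = range (eval21 B v)"
    have CB: "C \<subseteq> carrier B"
      using eval21_closed[OF B v] by (auto simp: C_def)
    have vC: "v i \<in> C" for i
      unfolding C_def by (metis eval21.simps(1) rangeI)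
    have mulC: "mul B x y \<in> C" if "x \<in> C" "y \<in> C" for x y
      proof -
      obtain s t where "x = eval21 B v s" "y = eval21 B v t" using \<open>x \<in> C\<close> \<open>y \<in> C\<close> by (auto simp: C_def)
      then have "mul B x y = eval21 B v (Mul s t)" by simp
      then show ?thesis by (simp only: C_def rangeI)
    qed
    have starC: "star B x \<in> C" if "x \<in> C" for x
      proof -
      obtain s where "x = eval21 B v s" using \<open>x \<in> C\<close> by (auto simp: C_def)
      then have "star B x = eval21 B v (Star s)" by simp
      then show ?thesis by (simp only: C_def rangeI)
    qed
    have "countable C" by (simp add: C_def)
    obtain g :: "nat \<Rightarrow> 'b" where g: "inj g"
      using infinite_countable_subset[OF inf] by blast
    define f where "f = g \<circ> to_nat_on C"
    define h where "h = inv_into C f"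
    have inj: "inj_on f C"
      unfolding f_def using \<open>countable C\<close> g
      by (meson comp_inj_on inj_on_to_nat_on inj_on_subset subset_UNIV)
    have hf: "h (f x) = x" if "x \<in> C" for x
      using that inj by (simp add: h_def)
    have hC: "h y \<in> C" if "y \<in> f ` C" for y
      using that unfolding h_def by (rule inv_into_into)
    have fh: "f (h y) = y" if "y \<in> f ` C" for y
      using that unfolding h_def by (rule f_inv_into_f)
    define D :: "'b alg21" where
      "D = \<lparr>carrier = f ` C, mul = \<lambda>x y. f (mul B (h x) (h y)), star = \<lambda>x. f (star B (h x))\<rparr>"
    have D: "algebra21 D"
      using vC mulC starC hC by (auto simp: algebra21_def D_def hf)
    have evC: "eval21 B (h \<circ> w) t \<in> C" if "range w \<subseteq> f ` C" for w t
      using that hC mulC starC by (induction t) auto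
    have ev: "eval21 D w t = f (eval21 B (h \<circ> w) t)" if w: "range w \<subseteq> f ` C" for w t
    proof (induction t)
      case (Var i)
      have "w i \<in> f ` C" using w by blast
      then show ?case by (simp add: fh)
    qed (simp_all add: D_def hf comp_def evC[OF w, unfolded comp_def])
    have "satisfies D e'" if "e' \<in> \<Sigma>" for e'
      unfolding satisfies_def
    proof (intro allI impI)
      fix w :: "nat \<Rightarrow> 'b"
      assume "range w \<subseteq> carrier D"
      then have w: "range w \<subseteq> f ` C" by (simp add: D_def)
      then have "range (h \<circ> w) \<subseteq> carrier B" using hC CB by auto
      then have "eval21 B (h \<circ> w) (fst e') = eval21 B (h \<circ> w) (snd e')"
        using sat that unfolding satisfies_def by blast
      then show "eval21 D w (fst e') = eval21 D w (snd e')" by (simp add: ev[OF w])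
    qed
    then have De: "satisfies D e"
      using basis D e by (auto simp: identity_basis_over_def)
    have w: "range (f \<circ> v) \<subseteq> f ` C" using vC by auto
    then have "eval21 D (f \<circ> v) (fst e) = eval21 D (f \<circ> v) (snd e)"
      using De by (simp add: satisfies_def D_def)
    moreover have "h \<circ> (f \<circ> v) = v" using hf vC by auto
    ultimately have "f (eval21 B v (fst e)) = f (eval21 B v (snd e))"
      by (simp add: ev[OF w])
    then show "eval21 B v (fst e) = eval21 B v (snd e)"
      using inj by (auto simp: C_def dest: inj_onD)
  qed
qed

lemma identity_basis_imp: "identity_basis A \<Sigma> \<Longrightarrow> identity_basis_over TYPE('b) A \<Sigma>"
  unfolding identity_basis_def by (rule identity_basis_over_transfer) simp_all

section \<open>Groups\<close>

definition Dedekind_group :: "('a, 'b) monoid_scheme \<Rightarrow> bool" where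
  "Dedekind_group G \<longleftrightarrow> group G \<and> (\<forall>H. subgroup H G \<longrightarrow> H \<lhd> G)"

definition power_involution_semigroup :: "('a, 'b) monoid_scheme \<Rightarrow> 'a set alg21" where
  "power_involution_semigroup G =
     \<lparr>carrier = Pow (carrier G), mul = (\<lambda>A B. A <#>\<^bsub>G\<^esub> B), star = (\<lambda>A. set_inv\<^bsub>G\<^esub> A)\<rparr>"

lemma involution_semigroup_power:
  fixes G (structure)
  assumes "group G"
  shows "involution_semigroup (power_involution_semigroup G)"
proof -
  interpret group G by fact
  have "set_inv (A <#> B) = set_inv B <#> set_inv A"
    if "A \<subseteq> carrier G" "B \<subseteq> carrier G" for A B
  proof -
    have "inv (a \<otimes> b) = inv b \<otimes> inv a" if "a \<in> A" "b \<in> B" for a b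
      using that \<open>A \<subseteq> carrier G\<close> \<open>B \<subseteq> carrier G\<close> by (auto intro: inv_mult_group)
    then show ?thesis by (force simp: SET_INV_def set_mult_def)
  qed
  moreover have "set_inv (set_inv A) = A" if "A \<subseteq> carrier G" for A
    using that by (force simp: SET_INV_def)
  moreover have "set_inv A \<subseteq> carrier G" if "A \<subseteq> carrier G" for A
    using that by (auto simp: SET_INV_def)
  ultimately show ?thesis
    by (auto simp: involution_semigroup_def algebra21_def power_involution_semigroup_def
        set_mult_assoc dest: set_mult_closed)
qed

end

theory Submission
  imports Defs "HOL-Library.Multiset"
begin

text \<open>
  A word \<open>v\<close> whose values in \<open>G\<close> lie in a trivial member of the derived series gives the identity
  \<open>(vy)\<^sup>m v \<approx> (vy)\<^sup>m\<close> of the power semigroup: the value \<open>V\<close> of \<open>v\<close> contains \<open>1\<close>, and for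
  \<open>m = |G|\<close> the sizes of the powers of \<open>VY\<close> have stabilised, so multiplying by \<open>V\<close> changes nothing.

  For each \<open>k\<close>, we choose such a \<open>v\<close> together with an involution semigroup of partial injections on
  the positions \<open>0, \<dots>, |v|\<close> of \<open>v\<close> in which every letter acts by moving along its occurrences and
  \<open>y\<close> jumps from the end back to the start. There \<open>(vy)\<^sup>m\<close> fixes \<open>0\<close> while \<open>(vy)\<^sup>m v\<close> moves \<open>0\<close> to
  \<open>|v|\<close>, so the identity fails. A non-normal subgroup \<open>H\<close> and an element \<open>g\<close> outside its normaliser
  put the Brandt monoid \<open>B\<^sub>2\<^sup>1\<close> into the variety of the power semigroup, as the sets
  \<open>1, H, Hg, g\<inverse>H, g\<inverse>Hg\<close> with all larger sets acting as zero. So it suffices that identities of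
  \<open>B\<^sub>2\<^sup>1\<close> in \<open>k\<close> variables hold in the semigroup of partial injections. This follows if any \<open>k\<close> of its
  elements admit enough two-colourings of the positions under which each of them either preserves
  colours or always joins the same two colours.

  The word \<open>v\<close> is an iterated product of blocks, each used once positively and once negatively, whose
  negative halves are permuted so that no two blocks are close to each other in both halves. Only \<open>k\<close>
  blocks of each level matter for \<open>k\<close> given elements, and all other blocks can be cut freely.
\<close>

section \<open>Positions in recursively built block words\<close>

text \<open>Positions are the \<open>N + 1\<close> gaps around the letters of a block of length
  \<open>N\<close>, so neighbouring places share an end point. An inverted block runs through its
  positions from right to left.\<close>

definition emb :: "(nat \<Rightarrow> bool) \<Rightarrow> nat \<Rightarrow> nat \<Rightarrow> nat \<Rightarrow> nat" where
  "emb pos N q s = (if pos q then q * N + s else (q + 1) * N - s)"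

lemma emb_bounds: "s \<le> N \<Longrightarrow> q * N \<le> emb pos N q s \<and> emb pos N q s \<le> (q + 1) * N"
  by (auto simp: emb_def)

lemma emb_le: "s \<le> N \<Longrightarrow> q < M \<Longrightarrow> emb pos N q s \<le> M * N"
  using emb_bounds[of s N q pos] mult_le_mono1[of "q + 1" M N] by linarith

lemma emb_inj: "emb pos N q s = emb pos N q t \<Longrightarrow> s \<le> N \<Longrightarrow> t \<le> N \<Longrightarrow> s = t"
  by (auto simp: emb_def split: if_splits)

definition loc :: "(nat \<Rightarrow> bool) \<Rightarrow> nat \<Rightarrow> nat \<Rightarrow> nat \<Rightarrow> nat" where
  "loc pos N q p = (if pos q then p - q * N else (q + 1) * N - p)"

lemma loc_le: "q * N \<le> p \<Longrightarrow> p \<le> (q + 1) * N \<Longrightarrow> loc pos N q p \<le> N"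
  by (auto simp: loc_def)

lemma emb_loc: "q * N \<le> p \<Longrightarrow> p \<le> (q + 1) * N \<Longrightarrow> emb pos N q (loc pos N q p) = p"
  by (auto simp: loc_def emb_def)

lemma loc_emb: "s \<le> N \<Longrightarrow> loc pos N q (emb pos N q s) = s"
  by (auto simp: loc_def emb_def)

lemma loc_inj:
  "loc pos N q p = loc pos N q r \<Longrightarrow> q * N \<le> p \<Longrightarrow> p \<le> (q + 1) * N \<Longrightarrow> q * N \<le> r \<Longrightarrow> r \<le> (q + 1) * N \<Longrightarrow> p = r"
  by (metis emb_loc)

text \<open>A word of the next level is a sequence of \<open>M\<close> blocks: place \<open>q\<close> carries the block number
  \<open>child q\<close>, inverted unless \<open>pos q\<close>, and \<open>twin q\<close> is the only other place carrying the same block.\<close>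

locale block_sequence =
  fixes M k :: nat and pos :: "nat \<Rightarrow> bool" and child twin :: "nat \<Rightarrow> nat"
  assumes M_pos: "0 < M" and k_pos: "0 < k"
    and twin_less: "q < M \<Longrightarrow> twin q < M"
    and child_twin: "q < M \<Longrightarrow> child (twin q) = child q"
    and twin_twin: "q < M \<Longrightarrow> twin (twin q) = q"
    and child_eqD: "q < M \<Longrightarrow> r < M \<Longrightarrow> child q = child r \<Longrightarrow> r = q \<or> r = twin q"
    and twin_far: "q < M \<Longrightarrow> q + 2 * k < twin q \<or> twin q + 2 * k < q"
    and pair_far: "\<lbrakk>q < M; r < M; child q \<noteq> child r; q \<le> r + 2 * k; r \<le> q + 2 * k\<rbrakk>
      \<Longrightarrow> twin q + 2 * k < twin r \<or> twin r + 2 * k < twin q"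
begin

abbreviation "cp \<equiv> emb pos"

text \<open>A list \<open>\<alpha>\<close> of block numbers, outermost first, is the address of a nested block; \<open>positions l \<alpha> s\<close>
  are the places in the word of level \<open>l\<close> where its \<open>s\<close>-th position occurs. Addresses longer than \<open>l\<close>
  have no occurrence.\<close>

fun positions :: "nat \<Rightarrow> nat list \<Rightarrow> nat \<Rightarrow> nat set" where
  "positions l [] s = {s}"
| "positions (Suc l) (i # \<alpha>) s = (\<Union>q\<in>{q. q < M \<and> child q = i}. cp (M ^ l) q ` positions l \<alpha> s)"
| "positions 0 (i # \<alpha>) s = {}"

text \<open>Goodness is inherited along the address, and ensures that all occurrences of the addressed
  block are coloured alike or that each of them is monochromatic (see \<open>uniform_jump\<close>).\<close>

fun good :: "nat \<Rightarrow> nat list \<Rightarrow> (nat \<Rightarrow> bool) \<Rightarrow> bool" where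
  "good l [] f = True"
| "good (Suc l) (i # \<alpha>) f =
    ((\<exists>g. good l \<alpha> g \<and> (\<forall>q<M. child q = i \<longrightarrow> (\<forall>p\<le>M ^ l. f (cp (M ^ l) q p) = g p))) \<or>
     (\<forall>q<M. child q = i \<longrightarrow> (\<exists>c. \<forall>p\<le>M ^ l. f (cp (M ^ l) q p) = c)))"
| "good 0 (i # \<alpha>) f = True"

lemma positions_le: "s \<le> M ^ (l - length \<alpha>) \<Longrightarrow> d \<in> positions l \<alpha> s \<Longrightarrow> d \<le> M ^ l"
proof (induction l \<alpha> s arbitrary: d rule: positions.induct)
  case (2 l i \<alpha> s)
  then show ?case using emb_le by fastforce
qed auto

text \<open>A block occurs at no more than two places, so \<open>k\<close> blocks fill at most
  \<open>2 * k\<close> places. This is the origin of the distance \<open>2 * k\<close> in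
  \<open>twin_far\<close> and \<open>pair_far\<close>.\<close>

lemma card_touched:
  assumes "finite L" "card L \<le> k"
  shows "finite {q. q < M \<and> child q \<in> L}" "card {q. q < M \<and> child q \<in> L} \<le> 2 * k"
proof -
  have fib: "finite {q. q < M \<and> child q = i} \<and> card {q. q < M \<and> child q = i} \<le> 2" for i
  proof (cases "\<exists>q<M. child q = i")
    case True
    then obtain q where q: "q < M" "child q = i" by blast
    then have "{q. q < M \<and> child q = i} \<subseteq> {q, twin q}" using child_eqD by fastforce
    moreover have "card {q, twin q} \<le> 2" by (simp add: card_insert_if)
    ultimately show ?thesis
      by (meson card_mono finite.emptyI finite.insertI finite_subset le_trans)
  next
    case False
    then have "{q. q < M \<and> child q = i} = {}" by blast
    then show ?thesis by (simp only: finite.emptyI card.empty) simp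
  qed
  have eq: "{q. q < M \<and> child q \<in> L} = (\<Union>i\<in>L. {q. q < M \<and> child q = i})" by auto
  show "finite {q. q < M \<and> child q \<in> L}" by simp
  have "card {q. q < M \<and> child q \<in> L} \<le> (\<Sum>i\<in>L. card {q. q < M \<and> child q = i})"
    unfolding eq by (rule card_UN_le[OF assms(1)])
  also have "\<dots> \<le> (\<Sum>i\<in>L. 2)" by (rule sum_mono) (use fib in blast)
  finally show "card {q. q < M \<and> child q \<in> L} \<le> 2 * k" using assms(2) by simp
qed

text \<open>\<open>L\<close> is the set of the at most \<open>k\<close> blocks that may not be cut: \<open>p\<close> and \<open>p'\<close> are linked if every
  letter between them belongs to such a block.\<close>

definition linked :: "nat \<Rightarrow> nat set \<Rightarrow> nat \<Rightarrow> nat \<Rightarrow> bool" where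
  "linked N L p p' \<longleftrightarrow> (\<forall>j. min p p' \<le> j \<longrightarrow> j < max p p' \<longrightarrow> j div N < M \<and> child (j div N) \<in> L)"

lemma linked_refl: "linked N L p p"
  by (simp add: linked_def)

lemma linked_sym: "linked N L p p' = linked N L p' p"
  by (simp add: linked_def min.commute max.commute)

lemma linked_trans: "linked N L p p' \<Longrightarrow> linked N L p' p'' \<Longrightarrow> linked N L p p''"
  unfolding linked_def min_def max_def by (smt (verit) leI le_trans less_le_trans le_less_trans linorder_linear)

lemma linked_block:
  assumes "r < M" "child r \<in> L" "r * N \<le> p" "p \<le> (r + 1) * N" "r * N \<le> p'" "p' \<le> (r + 1) * N"
  shows "linked N L p p'"
  unfolding linked_def
proof (intro allI impI)
  fix j assume "min p p' \<le> j" "j < max p p'"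
  then have "r * N \<le> j" "j < (r + 1) * N" using assms(3-6) by linarith+
  then have "j div N = r" by (intro div_nat_eqI) (auto simp: algebra_simps)
  then show "j div N < M \<and> child (j div N) \<in> L" using assms by simp
qed

text \<open>All places from \<open>q\<close> up to \<open>r\<close> carry blocks of
  \<open>L\<close>, and there are at most \<open>2 * k\<close> such places.\<close>

lemma linked_near:
  assumes "finite L" "card L \<le> k" "0 < N" "linked N L (q * N) (r * N)" "q \<le> r"
  shows "r \<le> q + 2 * k"
proof -
  have "{q..<r} \<subseteq> {q. q < M \<and> child q \<in> L}"
  proof
    fix j assume j: "j \<in> {q..<r}"
    then have "q * N \<le> j * N" "j * N < r * N" using assms(3) by auto
    then have "j * N div N < M \<and> child (j * N div N) \<in> L"
      using assms(4,5) unfolding linked_def by (meson max.strict_coboundedI2 min.coboundedI1)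
    then show "j \<in> {q. q < M \<and> child q \<in> L}" using assms(3) by simp
  qed
  then have "card {q..<r} \<le> 2 * k"
    using card_touched[OF assms(1,2)] card_mono le_trans by blast
  then show ?thesis by simp
qed

text \<open>Hence no position is linked to both occurrences of a block, and the two branches of
  \<open>glue\<close> cannot conflict.\<close>

lemma not_linked_twin:
  assumes "finite L" "card L \<le> k" "0 < N" "q < M"
  shows "\<not> linked N L (q * N) (twin q * N)"
  using linked_near[OF assms(1-3), of q "twin q"] linked_near[OF assms(1-3), of "twin q" q]
    twin_far[OF assms(4)] linked_sym by (metis leD nat_le_linear le_add1 le_trans)

text \<open>Two links would bring both pairs of places within distance \<open>2 * k\<close>, against
  \<open>pair_far\<close>. In \<open>separation\<close> this shows that the second occurrence of a
  block receives the default colour.\<close>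

lemma not_linked_twin_twin:
  assumes "finite L" "card L \<le> k" "0 < N" "q < M" "r < M" "child q \<noteq> child r"
    and "linked N L (q * N) (r * N)"
  shows "\<not> linked N L (twin q * N) (twin r * N)"
proof
  assume c: "linked N L (twin q * N) (twin r * N)"
  have "q \<le> r + 2 * k" "r \<le> q + 2 * k"
    using linked_near[OF assms(1-3), of q r] linked_near[OF assms(1-3), of r q] assms(7) linked_sym
    by (metis nat_le_linear trans_le_add1)+
  moreover have "twin q \<le> twin r + 2 * k" "twin r \<le> twin q + 2 * k"
    using linked_near[OF assms(1-3), of "twin q" "twin r"] linked_near[OF assms(1-3), of "twin r" "twin q"] c linked_sym
    by (metis nat_le_linear trans_le_add1)+
  ultimately show False using pair_far[OF assms(4-6)] by linarith
qed

section \<open>Extending a colouring of one block to the whole word\<close>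

definition clamp :: "nat \<Rightarrow> nat \<Rightarrow> nat \<Rightarrow> nat" where
  "clamp N q p = max (q * N) (min p ((q + 1) * N))"

text \<open>Extends a colouring \<open>g\<close> of one block to the whole word: it is copied to both occurrences and
  continued as a constant on either side up to the next block that may be cut.\<close>

definition glue :: "nat \<Rightarrow> nat set \<Rightarrow> nat \<Rightarrow> (nat \<Rightarrow> bool) \<Rightarrow> bool \<Rightarrow> nat \<Rightarrow> bool" where
  "glue N L q g c p =
    (if linked N L p (q * N) then g (loc pos N q (clamp N q p))
     else if linked N L p (twin q * N) then g (loc pos N (twin q) (clamp N (twin q) p)) else c)"

lemma clamp_const:
  assumes "r \<noteq> q" "r * N \<le> p" "p \<le> (r + 1) * N"
  shows "clamp N q p = (if r < q then q * N else (q + 1) * N)"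
proof (cases "r < q")
  case True
  then have "(r + 1) * N \<le> q * N" by (intro mult_le_mono1) simp
  then show ?thesis using True assms unfolding clamp_def by (simp add: max_def min_def)
next
  case False
  then have "(q + 1) * N \<le> r * N" using assms(1) by (intro mult_le_mono1) simp
  then show ?thesis using False assms unfolding clamp_def by (auto simp add: max_def min_def)
qed

lemma glue_copy:
  assumes L: "finite L" "card L \<le> k" "0 < N" and q: "q < M" "child q \<in> L"
    and r: "r < M" "child r = child q" and p: "p \<le> N"
  shows "glue N L q g c (cp N r p) = g p"
proof -
  have b: "r * N \<le> cp N r p" "cp N r p \<le> (r + 1) * N" using emb_bounds[OF p] by auto
  have cr: "linked N L (cp N r p) (r * N)"
    using linked_block[of r L N] b r q by simp
  have cl: "clamp N r (cp N r p) = cp N r p" using b by (simp add: clamp_def)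
  consider "r = q" | "r = twin q" using child_eqD q r by metis
  then show ?thesis
  proof cases
    case 1
    then show ?thesis using cr cl loc_emb[OF p] by (simp add: glue_def)
  next
    case 2
    have "\<not> linked N L (cp N r p) (q * N)"
      using not_linked_twin[OF L q(1)] cr linked_sym linked_trans 2 by metis
    then show ?thesis using cr cl loc_emb[OF p] 2 by (simp add: glue_def)
  qed
qed

text \<open>The positions of an uncut block are linked to each other, so all fall into the same
  branch of \<open>glue\<close>. The block lies on one side of the glued one, so
  \<open>clamp\<close> sends all of it to one end point.\<close>

lemma glue_other:
  assumes q: "q < M" and r: "r < M" "child r \<noteq> child q" "child r \<in> L"
  shows "\<exists>d. \<forall>p\<le>N. glue N L q g c (cp N r p) = d"
proof -
  have rq: "r \<noteq> q" "r \<noteq> twin q" using r q child_twin by auto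
  have "glue N L q g c (cp N r p) = glue N L q g c (cp N r 0)" if p: "p \<le> N" for p
  proof -
    have b: "r * N \<le> cp N r p" "cp N r p \<le> (r + 1) * N" "r * N \<le> cp N r 0" "cp N r 0 \<le> (r + 1) * N"
      using emb_bounds[OF p] emb_bounds[of 0 N] by auto
    have "linked N L (cp N r p) (cp N r 0)" using linked_block r b by blast
    then have "linked N L (cp N r p) x = linked N L (cp N r 0) x" for x
      using linked_sym linked_trans by metis
    then show ?thesis unfolding glue_def using clamp_const rq b by simp
  qed
  then show ?thesis by blast
qed

text \<open>Addresses starting in the glued block use the first alternative of \<open>good\<close>,
  those starting in other blocks of \<open>L\<close> the second.\<close>

lemma good_glue:
  assumes L: "finite L" "card L \<le> k" and q: "q < M" "child q \<in> L"
    and AL: "\<forall>i \<beta>. i # \<beta> \<in> A \<longrightarrow> i \<in> L" and g: "\<forall>\<beta>. child q # \<beta> \<in> A \<longrightarrow> good l \<beta> g" and A: "\<beta> \<in> A"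
  shows "good (Suc l) \<beta> (glue (M ^ l) L q g c)"
proof (cases \<beta>)
  case (Cons i \<beta>')
  have N: "0 < M ^ l" using M_pos by simp
  show ?thesis
  proof (cases "i = child q")
    case True
    then have "good l \<beta>' g" using g A Cons by blast
    then show ?thesis unfolding Cons using glue_copy[OF L N q] True by auto
  next
    case False
    have "i \<in> L" using AL A Cons by blast
    then show ?thesis unfolding Cons using glue_other[OF q(1)] False by auto
  qed
qed simp

text \<open>The positions of an uncut block are linked to each other, so this colouring is constant
  on each of its occurrences.\<close>

lemma good_linked:
  assumes AL: "\<forall>i \<beta>. i # \<beta> \<in> A \<longrightarrow> i \<in> L" and A: "\<beta> \<in> A"
  shows "good (Suc l) \<beta> (\<lambda>p. linked (M ^ l) L p t)"
proof (cases \<beta>)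
  case (Cons i \<beta>')
  have "i \<in> L" using AL A Cons by blast
  have "\<exists>c. \<forall>p\<le>M ^ l. linked (M ^ l) L (cp (M ^ l) q p) t = c" if "q < M" "child q = i" for q
  proof (intro exI allI impI)
    fix p assume p: "p \<le> M ^ l"
    have "linked (M ^ l) L (cp (M ^ l) q p) (cp (M ^ l) q 0)"
      by (rule linked_block[of q]) (use that \<open>i \<in> L\<close> emb_bounds[OF p] emb_bounds[of 0] in auto)
    then show "linked (M ^ l) L (cp (M ^ l) q p) t = linked (M ^ l) L (cp (M ^ l) q 0) t"
      using linked_sym linked_trans by metis
  qed
  then show ?thesis unfolding Cons by simp
qed simp

text \<open>Induction on the level. Either a cut separates \<open>t\<close> from all the
  occurrences, or the problem moves into a single block, where the induction hypothesis gives a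
  colouring that \<open>glue\<close> extends. The address \<open>[]\<close> stands for separating
  two points; the step for nonempty addresses needs this case as well.\<close>

lemma separation:
  assumes "finite A" "card A \<le> k" "\<alpha> \<in> A \<or> \<alpha> = []"
    and "s \<le> M ^ (l - length \<alpha>)" "t \<le> M ^ l" "t \<notin> positions l \<alpha> s"
  shows "\<exists>f. (\<forall>\<beta>\<in>A. good l \<beta> f) \<and> (\<exists>c. (\<forall>d\<in>positions l \<alpha> s. f d = c) \<and> f t \<noteq> c)"
  using assms
proof (induction l arbitrary: A \<alpha> s t)
  case 0
  have "good 0 \<beta> f" for \<beta> f by (cases \<beta>) auto
  moreover have "\<forall>d\<in>positions 0 \<alpha> s. (d = t) = False" using "0.prems"(6) by auto
  ultimately show ?case by (intro exI[of _ "\<lambda>d. d = t"]) auto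
next
  case (Suc l)
  define N where "N = M ^ l"
  have N: "0 < N" using M_pos by (simp add: N_def)
  \<comment> \<open>Only blocks in which an address of \<open>A\<close> starts must stay uncut;
    \<open>sub i\<close> collects what remains of these addresses inside block
    \<open>i\<close>.\<close>
  define L where "L = {i. \<exists>\<beta>. i # \<beta> \<in> A}"
  define sub where "sub i = {\<beta>. i # \<beta> \<in> A}" for i
  have AL: "\<forall>i \<beta>. i # \<beta> \<in> A \<longrightarrow> i \<in> L" by (auto simp: L_def)
  have "L \<subseteq> hd ` A" by (force simp: L_def)
  then have L: "finite L" "card L \<le> k"
    using Suc.prems(1,2) by (meson finite_imageI finite_subset card_image_le card_mono le_trans)+
  have sub: "finite (sub i)" "card (sub i) \<le> k" for i
  proof -
    have im: "(\<lambda>\<beta>. i # \<beta>) ` sub i \<subseteq> A" and inj: "inj_on (\<lambda>\<beta>. i # \<beta>) (sub i)"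
      by (auto simp: sub_def)
    show "finite (sub i)" using Suc.prems(1) im inj by (meson finite_imageD finite_subset)
    show "card (sub i) \<le> k" using card_inj_on_le[OF inj im Suc.prems(1)] Suc.prems(2) by simp
  qed
  have glue: "\<forall>\<beta>\<in>A. good (Suc l) \<beta> (glue N L q g c)"
    if "q < M" "child q \<in> L" "\<forall>\<beta>\<in>sub (child q). good l \<beta> g" for q g c
    using good_glue[OF L that(1,2) AL] that(3) by (simp add: sub_def N_def)
  have step: "\<forall>\<beta>\<in>A. good (Suc l) \<beta> (\<lambda>p. linked N L p t)" for t
    using good_linked[OF AL] by (simp add: N_def)
  have points: "\<exists>g. (\<forall>\<beta>\<in>sub i. good l \<beta> g) \<and> g x \<noteq> g y" if "x \<noteq> y" "x \<le> N" "y \<le> N" for i x y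
    using Suc.IH[OF sub, of "[]" i x y] that by (auto simp: N_def)
  show ?case
  proof (cases \<alpha>)
    case Nil
    have pts: "\<exists>f. (\<forall>\<beta>\<in>A. good (Suc l) \<beta> f) \<and> f s \<noteq> f t" if "s < t" "t \<le> M * N" for s t
    proof (cases "linked N L s t")
      case False
      then show ?thesis using step[of t] linked_refl by blast
    next
      case True
      define q where "q = s div N"
      have q: "q < M" "child q \<in> L" using True that(1) by (auto simp: linked_def q_def)
      have sq: "q * N \<le> s" "s < (q + 1) * N"
        unfolding q_def using N by (simp_all add: dividend_less_div_times mult.commute[of _ N] dividend_less_times_div)
      have cs: "linked N L s (q * N)" using linked_block q sq N by simp
      then have ct: "linked N L t (q * N)" using True linked_sym linked_trans by metis
      \<comment> \<open>If \<open>t\<close> lies beyond the block containing \<open>s\<close>, it is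
        represented by the right end of that block, which still differs from
        \<open>s\<close>.\<close>
      have cl: "clamp N q s = s" "clamp N q t = min t ((q + 1) * N)"
        using sq that by (auto simp: clamp_def)
      have lt: "s < min t ((q + 1) * N)" using that sq by simp
      define u where "u = min t ((q + 1) * N)"
      have u: "q * N \<le> u" "u \<le> (q + 1) * N" using lt sq by (auto simp: u_def)
      have "loc pos N q s \<noteq> loc pos N q u"
        using loc_inj[of pos N q s u] lt sq u by (auto simp: u_def)
      then obtain g where g: "\<forall>\<beta>\<in>sub (child q). good l \<beta> g"
          "g (loc pos N q s) \<noteq> g (loc pos N q u)"
        using points[of "loc pos N q s" "loc pos N q u" "child q"]
          loc_le[OF sq(1) less_imp_le[OF sq(2)]] loc_le[OF u] by blast
      then have "glue N L q g True s \<noteq> glue N L q g True t"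
        unfolding glue_def using cs ct cl by (simp add: u_def)
      then show ?thesis using glue[OF q g(1)] by blast
    qed
    have "s \<noteq> t" "s \<le> M * N" "t \<le> M * N" using Suc.prems Nil by (auto simp: N_def)
    then obtain f where "\<forall>\<beta>\<in>A. good (Suc l) \<beta> f" "f s \<noteq> f t"
      using pts[of s t] pts[of t s] by (metis linorder_neqE_nat)
    then show ?thesis using Nil by auto
  next
    case (Cons i \<alpha>')
    have i: "i \<in> L" using Suc.prems(3) Cons by (auto simp: L_def)
    define D where "D = positions l \<alpha>' s"
    have D: "positions (Suc l) \<alpha> s = (\<Union>q\<in>{q. q < M \<and> child q = i}. cp N q ` D)"
      by (simp add: Cons D_def N_def)
    have DN: "d \<le> N" if "d \<in> D" for d
      using positions_le[of s l \<alpha>'] that Suc.prems(4) Cons by (simp add: D_def N_def)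
    have cD: "linked N L (cp N q d) (q * N)" if "q < M" "child q = i" "d \<in> D" for q d
      using linked_block[of q L N] that i emb_bounds[OF DN[OF that(3)]] by simp
    show ?thesis
    proof (cases "\<exists>q<M. child q = i \<and> linked N L t (q * N)")
      case False
      have "\<not> linked N L d t" if "d \<in> positions (Suc l) \<alpha> s" for d
        using that False cD linked_sym linked_trans unfolding D by blast
      then show ?thesis
        using step[of t] linked_refl[of N L t] by (intro exI[of _ "\<lambda>p. linked N L p t"]) auto
    next
      case True
      then obtain r where r: "r < M" "child r = i" "linked N L t (r * N)" by blast
      show ?thesis
      proof (cases "r * N \<le> t \<and> t \<le> (r + 1) * N")
        case True
        define t0 where "t0 = loc pos N r t"
        have t0: "t0 \<le> N" "cp N r t0 = t" using True loc_le emb_loc by (auto simp: t0_def)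
        then have "t0 \<notin> D" using Suc.prems(6) r unfolding D by blast
        moreover have "\<alpha>' \<in> sub i \<or> \<alpha>' = []" using Suc.prems(3) Cons by (auto simp: sub_def)
        ultimately obtain g c where g: "\<forall>\<beta>\<in>sub i. good l \<beta> g" "\<forall>d\<in>D. g d = c" "g t0 \<noteq> c"
          using Suc.IH[OF sub, of \<alpha>' i s t0] t0 Suc.prems(4) Cons by (auto simp: N_def D_def)
        have c: "glue N L r g c (cp N q p) = g p" if "q < M" "child q = i" "p \<le> N" for q p
          using glue_copy[OF L N r(1) _ that(1) _ that(3)] that r i by simp
        have "glue N L r g c t \<noteq> c" using c[OF r(1,2) t0(1)] t0(2) g(3) by simp
        moreover have "\<forall>d\<in>positions (Suc l) \<alpha> s. glue N L r g c d = c" using c g(2) DN unfolding D by auto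
        ultimately show ?thesis using glue[of r g c] r i g(1) by blast
      next
        case False
        \<comment> \<open>Here \<open>t\<close> is linked to the occurrence \<open>r\<close> from
          outside. The witnesses are an uncut block \<open>q\<close> containing \<open>t\<close> and
          its end \<open>e\<close> facing \<open>r\<close>, to which \<open>clamp\<close> sends all
          of \<open>r\<close>.\<close>
        obtain q e where q: "q < M" "child q \<in> L" "child q \<noteq> i" "q * N \<le> t" "t \<le> (q + 1) * N"
            "e = q * N \<or> e = (q + 1) * N" "t \<noteq> e"
          and e: "\<And>x. r * N \<le> x \<Longrightarrow> x \<le> (r + 1) * N \<Longrightarrow> clamp N q x = e"
          and cq: "linked N L (r * N) (q * N)"
        proof -
          have no: "child q \<noteq> i" if "q < M" "q \<noteq> r" "linked N L (r * N) (q * N)" for q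
            using child_eqD[OF r(1), of q] not_linked_twin[OF L N r(1)] that r(2) by metis
          show thesis
          proof (cases "t < r * N")
            case True
            define q where "q = t div N"
            have q: "q < M" "child q \<in> L" using True r(3) by (auto simp: linked_def q_def)
            have tq: "q * N \<le> t" "t < (q + 1) * N"
              unfolding q_def using N by (simp_all add: dividend_less_div_times mult.commute[of _ N] dividend_less_times_div)
            have qr: "q < r" using tq(1) True N by (metis le_less_trans mult_less_cancel2)
            have cq: "linked N L (r * N) (q * N)"
              using linked_block[of q L N t "q * N"] q tq N r(3) linked_sym linked_trans by (metis le_add1 le_refl less_imp_le_nat mult_le_mono1)
            show thesis
              using that[of q "(q + 1) * N"] q tq qr cq no[of q] clamp_const[of r q N] by auto
          next
            case False
            then have t: "(r + 1) * N < t" using \<open>\<not> (r * N \<le> t \<and> t \<le> (r + 1) * N)\<close> by simp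
            \<comment> \<open>The letter before \<open>t\<close> determines the place: if
              \<open>t\<close> is a boundary, \<open>t div N\<close> would give a place whose end
              facing \<open>r\<close> is \<open>t\<close> itself.\<close>
            define q where "q = (t - 1) div N"
            have q: "q < M" "child q \<in> L" using t r(3) by (auto simp: linked_def q_def)
            have "q * N \<le> t - 1" "t - 1 < (q + 1) * N"
              unfolding q_def using N by (simp_all add: dividend_less_div_times mult.commute[of _ N] dividend_less_times_div)
            then have tq: "q * N < t" "t \<le> (q + 1) * N" using t by linarith+
            have qr: "r < q"
            proof -
              have "(r + 1) * N < (q + 1) * N" using t tq(2) by linarith
              then show ?thesis using N by (simp only: mult_less_cancel2) simp
            qed
            have cq: "linked N L (r * N) (q * N)"
              using linked_block[of q L N t "q * N"] q tq N r(3) linked_sym linked_trans by (metis le_add1 le_refl less_imp_le_nat mult_le_mono1)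
            show thesis
              using that[of q "q * N"] q tq qr cq no[of q] clamp_const[of r q N] by auto
          qed
        qed
        have ee: "q * N \<le> e" "e \<le> (q + 1) * N" using q(6) by auto
        have "loc pos N q t \<noteq> loc pos N q e" using loc_inj q(4,5,7) ee by blast
        then obtain g where g: "\<forall>\<beta>\<in>sub (child q). good l \<beta> g" "g (loc pos N q t) \<noteq> g (loc pos N q e)"
          using points[of "loc pos N q t" "loc pos N q e"] loc_le q(4,5) ee by blast
        \<comment> \<open>The default is the colour of \<open>e\<close>: the twin of
          \<open>r\<close> is linked to neither occurrence of the block at \<open>q\<close>, yet
          must be coloured like \<open>r\<close>.\<close>
        define f where "f = glue N L q g (g (loc pos N q e))"
        have "clamp N q t = t" using q(4,5) by (simp add: clamp_def)
        moreover have "linked N L t (q * N)" using r(3) cq linked_trans by blast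
        ultimately have ft: "f t = g (loc pos N q t)" by (simp add: f_def glue_def)
        have "f (cp N q' d) = g (loc pos N q e)" if q': "q' < M" "child q' = i" "d \<in> D" for q' d
        proof -
          consider "q' = r" | "q' = twin r" using child_eqD r q' by metis
          then show ?thesis
          proof cases
            case 1
            then have "linked N L (cp N q' d) (q * N)" using cD[OF q'] cq linked_trans by blast
            then show ?thesis using e emb_bounds[OF DN[OF q'(3)]] 1 by (simp add: f_def glue_def)
          next
            case 2
            have "\<not> linked N L (q' * N) (q * N)"
              using not_linked_twin[OF L N r(1)] cq 2 linked_sym linked_trans by metis
            moreover have "\<not> linked N L (q' * N) (twin q * N)"
              using not_linked_twin_twin[OF L N r(1) q(1) _ cq] q(3) r(2) 2 by simp
            ultimately show ?thesis using cD[OF q'] linked_sym linked_trans by (metis f_def glue_def)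
          qed
        qed
        then have "\<forall>d\<in>positions (Suc l) \<alpha> s. f d = g (loc pos N q e)" unfolding D by blast
        then show ?thesis using glue[OF q(1,2) g(1)] ft g(2) unfolding f_def by metis
      qed
    qed
  qed
qed

end

section \<open>The algebra of jumps\<close>

context block_sequence
begin

definition lift :: "nat \<Rightarrow> nat \<Rightarrow> (nat \<times> nat) set \<Rightarrow> (nat \<times> nat) set" where
  "lift N i a = {(cp N q x, cp N q y) | q x y. q < M \<and> child q = i \<and> (x, y) \<in> a}"

text \<open>The partial injection moving the \<open>s\<close>-th position of every occurrence of a block to the
  \<open>s'\<close>-th position of the same occurrence.\<close>

fun jump :: "nat \<Rightarrow> nat list \<Rightarrow> nat \<Rightarrow> nat \<Rightarrow> (nat \<times> nat) set" where
  "jump l [] s s' = {(s, s')}"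
| "jump (Suc l) (i # \<alpha>) s s' = lift (M ^ l) i (jump l \<alpha> s s')"
| "jump 0 (i # \<alpha>) s s' = {}"

lemma Domain_jump: "Domain (jump l \<alpha> s s') = positions l \<alpha> s"
proof (induction l \<alpha> s s' rule: jump.induct)
  case (2 l i \<alpha> s s')
  have "Domain (lift N i a) = (\<Union>q\<in>{q. q < M \<and> child q = i}. cp N q ` Domain a)" for N a
    by (auto simp: lift_def Domain_iff)
  then show ?case using 2 by simp
qed auto

lemma lift_fstD:
  "(x, y) \<in> lift N i a \<Longrightarrow> a \<subseteq> {..N} \<times> {..N} \<Longrightarrow> \<exists>q d. q < M \<and> child q = i \<and> d \<le> N \<and> x = cp N q d"
  unfolding lift_def by blast

lemma lift_sndD:
  "(x, y) \<in> lift N i a \<Longrightarrow> a \<subseteq> {..N} \<times> {..N} \<Longrightarrow> \<exists>q d. q < M \<and> child q = i \<and> d \<le> N \<and> y = cp N q d"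
  unfolding lift_def by blast

lemma converse_lift: "(lift N i a)\<inverse> = lift N i (a\<inverse>)"
  by (auto simp: lift_def)

lemma converse_jump: "(jump l \<alpha> s s')\<inverse> = jump l \<alpha> s' s"
  by (induction l \<alpha> s s' rule: jump.induct) (auto simp: converse_lift)

lemma Range_jump: "Range (jump l \<alpha> s s') = positions l \<alpha> s'"
  by (metis Domain_converse Domain_jump converse_jump)

lemma jump_le:
  assumes "(x, y) \<in> jump l \<alpha> s s'" "s \<le> M ^ (l - length \<alpha>)" "s' \<le> M ^ (l - length \<alpha>)"
  shows "x \<le> M ^ l" "y \<le> M ^ l"
  using assms positions_le Domain_jump Range_jump by (metis Domain.DomainI RangeI)+

lemma block_near:
  assumes "cp N q d = cp N r e" "d \<le> N" "e \<le> N" "0 < N"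
  shows "q \<le> r + 1"
proof -
  have "q * N \<le> (r + 1) * N"
    using emb_bounds[OF assms(2), of q pos] emb_bounds[OF assms(3), of r pos] assms(1) by linarith
  then show ?thesis using assms(4) by (metis mult_le_cancel2)
qed

text \<open>Occurrences sharing a position are at most one place apart, while twins are more than
  \<open>2 * k\<close> places apart.\<close>

lemma copies_disjoint:
  assumes "cp N q d = cp N r e" "d \<le> N" "e \<le> N" "0 < N" "q < M" "r < M" "child q = child r"
  shows "q = r"
  using block_near[OF assms(1-4)] block_near[OF assms(1)[symmetric] assms(3,2,4)]
    twin_far[OF assms(5)] child_eqD[OF assms(5-7)] k_pos by auto

lemma single_valued_lift:
  assumes a: "single_valued a" "a \<subseteq> {..N} \<times> {..N}" and N: "0 < N"
  shows "single_valued (lift N i a)"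
proof (rule single_valuedI)
  fix x y z assume "(x, y) \<in> lift N i a" "(x, z) \<in> lift N i a"
  then obtain q d e r d' e' where *: "q < M" "child q = i" "(d, e) \<in> a" "x = cp N q d" "y = cp N q e"
      "r < M" "child r = i" "(d', e') \<in> a" "x = cp N r d'" "z = cp N r e'"
    by (auto simp: lift_def)
  have le: "d \<le> N" "d' \<le> N" using * a(2) by auto
  have "q = r" using copies_disjoint[of N q d r d'] * le N by simp
  moreover have "d = d'" using emb_inj * le calculation by metis
  ultimately show "y = z" using * a(1) by (auto dest: single_valuedD)
qed

lemma single_valued_jump:
  assumes "s \<le> M ^ (l - length \<alpha>)" "s' \<le> M ^ (l - length \<alpha>)"
  shows "single_valued (jump l \<alpha> s s')"
  using assms
proof (induction l \<alpha> s s' rule: jump.induct)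
  case (2 l i \<alpha> s s')
  have "jump l \<alpha> s s' \<subseteq> {..M ^ l} \<times> {..M ^ l}" using jump_le[of _ _ l \<alpha> s s'] 2 by auto
  then show ?case using single_valued_lift 2 M_pos by simp
qed (auto simp: single_valued_def)

text \<open>As occurrences of a block are disjoint, a composite path cannot pass from one to the
  other.\<close>

lemma lift_O_lift:
  assumes a: "a \<subseteq> {..N} \<times> {..N}" "b \<subseteq> {..N} \<times> {..N}" and N: "0 < N"
  shows "lift N i a O lift N i b = lift N i (a O b)"
proof (intro equalityI subrelI)
  fix x z assume "(x, z) \<in> lift N i a O lift N i b"
  then obtain q d e r d' e' where *: "q < M" "child q = i" "(d, e) \<in> a" "x = cp N q d"
      "r < M" "child r = i" "(d', e') \<in> b" "cp N q e = cp N r d'" "z = cp N r e'"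
    by (auto simp: lift_def)
  have le: "e \<le> N" "d' \<le> N" using * a by auto
  have "q = r" using copies_disjoint[of N q e r d'] * le N by simp
  moreover have "e = d'" using emb_inj * le calculation by metis
  ultimately show "(x, z) \<in> lift N i (a O b)" using * by (auto simp: lift_def)
next
  fix x z assume "(x, z) \<in> lift N i (a O b)"
  then show "(x, z) \<in> lift N i a O lift N i b" by (auto simp: lift_def)
qed

text \<open>Different places sharing a position are adjacent. Once one pair of occurrences is
  adjacent, \<open>pair_far\<close> and \<open>twin_far\<close> exclude every other pair, and
  adjacent places share only one end point.\<close>

lemma blocks_meet_once:
  assumes q: "q < M" "q' < M" "child q' = child q" and r: "r < M" "r' < M" "child r' = child r"
    and ne: "child q \<noteq> child r" and N: "0 < N" and le: "d \<le> N" "e \<le> N" "d' \<le> N" "e' \<le> N"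
    and y: "y = cp N q d" "y = cp N r e" and y': "y' = cp N q' d'" "y' = cp N r' e'"
  shows "y = y'"
proof -
  have near: "q \<le> r + 1" "r \<le> q + 1" "q' \<le> r' + 1" "r' \<le> q' + 1"
    using block_near y y' le N by metis+
  have "q' = q \<or> q' = twin q" "r' = r \<or> r' = twin r" using child_eqD q r by metis+
  moreover have "\<not> (twin q \<le> twin r + 1 \<and> twin r \<le> twin q + 1)"
    using pair_far[OF q(1) r(1) ne] near k_pos by auto
  moreover have "\<not> (twin q \<le> r + 1 \<and> r \<le> twin q + 1)" "\<not> (q \<le> twin r + 1 \<and> twin r \<le> q + 1)"
    using twin_far[OF q(1)] twin_far[OF r(1)] near k_pos by auto
  ultimately have eq: "q' = q" "r' = r" using near by auto
  have "q \<noteq> r" using ne by blast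
  moreover have "q * N \<le> y" "y \<le> (q + 1) * N" "r * N \<le> y" "y \<le> (r + 1) * N"
    "q * N \<le> y'" "y' \<le> (q + 1) * N" "r * N \<le> y'" "y' \<le> (r + 1) * N"
    using y y' eq le emb_bounds by metis+
  moreover have "q = r + 1 \<or> r = q + 1" using near calculation(1) by linarith
  ultimately show ?thesis by auto
qed

section \<open>Closure of jumps under composition\<close>

definition Jumps :: "nat \<Rightarrow> (nat \<times> nat) set set" where
  "Jumps l = insert {} {jump l \<alpha> s s' | \<alpha> s s'. s \<le> M ^ (l - length \<alpha>) \<and> s' \<le> M ^ (l - length \<alpha>)}"

lemma singleton_in_Jumps: "x \<le> M ^ l \<Longrightarrow> y \<le> M ^ l \<Longrightarrow> {(x, y)} \<in> Jumps l"
  unfolding Jumps_def by (intro insertI2 CollectI exI[of _ "[]"] exI[of _ x] exI[of _ y]) simp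

lemma Jumps_cases:
  assumes "a \<in> Jumps l"
  obtains "a = {}" | \<alpha> s s' where "a = jump l \<alpha> s s'" "s \<le> M ^ (l - length \<alpha>)" "s' \<le> M ^ (l - length \<alpha>)"
  using assms unfolding Jumps_def by blast

lemma Jumps_le: "a \<in> Jumps l \<Longrightarrow> a \<subseteq> {..M ^ l} \<times> {..M ^ l}"
  using jump_le by (elim Jumps_cases) auto

lemma single_valued_Jumps: "a \<in> Jumps l \<Longrightarrow> single_valued a"
  using single_valued_jump by (elim Jumps_cases) auto

lemma converse_Jumps: "a \<in> Jumps l \<Longrightarrow> a\<inverse> \<in> Jumps l"
  by (elim Jumps_cases) (auto simp: Jumps_def converse_jump)

lemma lift_Jumps: "a \<in> Jumps l \<Longrightarrow> lift (M ^ l) i a \<in> Jumps (Suc l)"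
proof (elim Jumps_cases)
  fix \<alpha> s s' assume "a = jump l \<alpha> s s'" "s \<le> M ^ (l - length \<alpha>)" "s' \<le> M ^ (l - length \<alpha>)"
  then show ?thesis unfolding Jumps_def
    by (intro insertI2 CollectI exI[of _ "i # \<alpha>"] exI[of _ s] exI[of _ s']) simp
qed (simp add: Jumps_def lift_def)

lemma Jumps_Suc_cases:
  assumes "a \<in> Jumps (Suc l)"
  obtains "a = {}" | x y where "a = {(x, y)}" "x \<le> M ^ Suc l" "y \<le> M ^ Suc l"
  | i a' where "a' \<in> Jumps l" "a = lift (M ^ l) i a'"
  using assms
proof (cases rule: Jumps_cases)
  case (2 \<alpha> s s')
  then show ?thesis
  proof (cases \<alpha>)
    case (Cons i \<alpha>')
    then have "jump l \<alpha>' s s' \<in> Jumps l" using 2 by (auto simp: Jumps_def)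
    then show ?thesis using that(3) 2 Cons by simp
  qed (use that(2) in simp)
qed

lemma subsingleton_in_Jumps:
  assumes "c \<subseteq> {..M ^ l} \<times> {..M ^ l}" "\<And>x y x' y'. (x, y) \<in> c \<Longrightarrow> (x', y') \<in> c \<Longrightarrow> x = x' \<and> y = y'"
  shows "c \<in> Jumps l"
proof (cases "c = {}")
  case False
  then obtain x y where xy: "(x, y) \<in> c" by auto
  then have "c = {(x, y)}" using assms(2) by auto
  then show ?thesis using singleton_in_Jumps assms(1) xy by auto
qed (simp add: Jumps_def)

text \<open>Lifts of the same block compose inside that block, one level lower. In all other cases
  at most one middle point is possible, so the result is empty or a single pair, which is a jump at
  the address \<open>[]\<close>.\<close>

lemma relcomp_Jumps: "a \<in> Jumps l \<Longrightarrow> b \<in> Jumps l \<Longrightarrow> a O b \<in> Jumps l"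
proof (induction l arbitrary: a b)
  case 0
  have "c = {} \<or> (\<exists>x y. c = {(x, y)} \<and> x \<le> 1 \<and> y \<le> 1)" if "c \<in> Jumps 0" for c
  proof (cases rule: Jumps_cases[OF that])
    case (2 \<alpha> s s')
    then show ?thesis by (cases \<alpha>) auto
  qed simp
  then consider "a = {} \<or> b = {}" | x y z w where "a = {(x, y)}" "b = {(z, w)}" "x \<le> 1" "w \<le> 1"
    using 0 by metis
  then show ?case
  proof cases
    case (2 x y z w)
    then have "a O b = (if y = z then {(x, w)} else {})" by auto
    then show ?thesis using singleton_in_Jumps[of x 0 w] 2 by (simp add: Jumps_def)
  qed (auto simp: Jumps_def)
next
  case (Suc l)
  have sv: "single_valued a" "single_valued b" "single_valued (a\<inverse>)" "single_valued (b\<inverse>)"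
    using single_valued_Jumps converse_Jumps Suc.prems by blast+
  have le: "a O b \<subseteq> {..M ^ Suc l} \<times> {..M ^ Suc l}"
    using Jumps_le[OF Suc.prems(1)] Jumps_le[OF Suc.prems(2)] by blast
  show ?case
  proof (cases "\<exists>i a' b'. a' \<in> Jumps l \<and> b' \<in> Jumps l \<and> a = lift (M ^ l) i a' \<and> b = lift (M ^ l) i b'")
    case True
    then show ?thesis using lift_O_lift[OF Jumps_le Jumps_le] lift_Jumps Suc.IH M_pos by auto
  next
    case False
    have "y = y'" if in_ab: "(x, y) \<in> a" "(y, z) \<in> b" "(x', y') \<in> a" "(y', z') \<in> b" for x y z x' y' z'
      using Suc.prems(1)
    proof (cases rule: Jumps_Suc_cases)
      case (3 i a')
      note a = 3
      show ?thesis using Suc.prems(2)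
      proof (cases rule: Jumps_Suc_cases)
        case (3 j b')
        have ij: "i \<noteq> j" using False a 3 by blast
        obtain q d where q: "q < M" "child q = i" "d \<le> M ^ l" "y = cp (M ^ l) q d"
          using lift_sndD[OF in_ab(1)[unfolded a(2)] Jumps_le[OF a(1)]] by blast
        obtain q' d' where q': "q' < M" "child q' = i" "d' \<le> M ^ l" "y' = cp (M ^ l) q' d'"
          using lift_sndD[OF in_ab(3)[unfolded a(2)] Jumps_le[OF a(1)]] by blast
        obtain r e where r: "r < M" "child r = j" "e \<le> M ^ l" "y = cp (M ^ l) r e"
          using lift_fstD[OF in_ab(2)[unfolded 3(2)] Jumps_le[OF 3(1)]] by blast
        obtain r' e' where r': "r' < M" "child r' = j" "e' \<le> M ^ l" "y' = cp (M ^ l) r' e'"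
          using lift_fstD[OF in_ab(4)[unfolded 3(2)] Jumps_le[OF 3(1)]] by blast
        show ?thesis
          using blocks_meet_once[of q q' r r' "M ^ l" d e d' e' y y'] q q' r r' ij M_pos by simp
      qed (use that in auto)
    qed (use that in auto)
    note middle = this
    have "x = x' \<and> z = z'" if two: "(x, z) \<in> a O b" "(x', z') \<in> a O b" for x z x' z'
    proof -
      obtain y y' where y: "(x, y) \<in> a" "(y, z) \<in> b" "(x', y') \<in> a" "(y', z') \<in> b"
        using two by blast
      have "y = y'" using middle[OF y] .
      then show ?thesis
        using y single_valuedD[OF sv(2), of y z z'] single_valuedD[OF sv(3), of y x x'] by simp
    qed
    then show ?thesis using subsingleton_in_Jumps[OF le] by blast
  qed
qed

text \<open>A jump never leaves an occurrence, so monochromatic occurrences preserve colours;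
  occurrences coloured alike inherit the claim from the inner block. The two outcomes match the
  singletons and the identity in \<open>B21\<close>.\<close>

lemma uniform_jump:
  assumes "good l \<alpha> f" "s \<le> M ^ (l - length \<alpha>)" "s' \<le> M ^ (l - length \<alpha>)"
  shows "(\<exists>c c'. \<forall>(x, y)\<in>jump l \<alpha> s s'. f x = c \<and> f y = c') \<or> (\<forall>(x, y)\<in>jump l \<alpha> s s'. f x = f y)"
  using assms
proof (induction l \<alpha> f rule: good.induct)
  case (2 l i \<alpha> f)
  have le: "x \<le> M ^ l" "y \<le> M ^ l" if "(x, y) \<in> jump l \<alpha> s s'" for x y
    using jump_le[OF that] 2(3,4) by auto
  have "(\<exists>g. good l \<alpha> g \<and> (\<forall>q<M. child q = i \<longrightarrow> (\<forall>p\<le>M ^ l. f (cp (M ^ l) q p) = g p))) \<or>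
      (\<forall>q<M. child q = i \<longrightarrow> (\<exists>c. \<forall>p\<le>M ^ l. f (cp (M ^ l) q p) = c))"
    using 2(2) by (simp only: good.simps)
  then show ?case
  proof (elim disjE exE conjE)
    fix g assume g: "good l \<alpha> g" and fg: "\<forall>q<M. child q = i \<longrightarrow> (\<forall>p\<le>M ^ l. f (cp (M ^ l) q p) = g p)"
    have "(\<exists>c c'. \<forall>(x, y)\<in>jump l \<alpha> s s'. g x = c \<and> g y = c') \<or> (\<forall>(x, y)\<in>jump l \<alpha> s s'. g x = g y)"
      using 2(1)[OF g] 2(3,4) by simp
    then show ?thesis
    proof
      assume "\<exists>c c'. \<forall>(x, y)\<in>jump l \<alpha> s s'. g x = c \<and> g y = c'"
      then obtain c c' where "\<forall>(x, y)\<in>jump l \<alpha> s s'. g x = c \<and> g y = c'" by blast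
      then have "\<forall>(x, y)\<in>jump (Suc l) (i # \<alpha>) s s'. f x = c \<and> f y = c'"
        using fg le by (auto simp: lift_def)
      then show ?thesis by blast
    next
      assume "\<forall>(x, y)\<in>jump l \<alpha> s s'. g x = g y"
      then have "\<forall>(x, y)\<in>jump (Suc l) (i # \<alpha>) s s'. f x = f y"
        using fg le by (auto simp: lift_def)
      then show ?thesis by blast
    qed
  next
    assume const: "\<forall>q<M. child q = i \<longrightarrow> (\<exists>c. \<forall>p\<le>M ^ l. f (cp (M ^ l) q p) = c)"
    have "f (cp (M ^ l) q x) = f (cp (M ^ l) q y)"
      if "q < M" "child q = i" "(x, y) \<in> jump l \<alpha> s s'" for q x y
      using const that(1,2) le[OF that(3)] by metis
    then have "\<forall>(x, y)\<in>jump (Suc l) (i # \<alpha>) s s'. f x = f y"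
      by (auto simp: lift_def)
    then show ?thesis by blast
  qed
qed auto

end

section \<open>Identities of the Brandt monoid\<close>

definition rel_algebra :: "('x \<times> 'x) set set \<Rightarrow> ('x \<times> 'x) set alg21" where
  "rel_algebra C = \<lparr>carrier = C, mul = (O), star = converse\<rparr>"

lemma rel_algebra_simps [simp]:
  "carrier (rel_algebra C) = C" "mul (rel_algebra C) a b = a O b" "star (rel_algebra C) a = a\<inverse>"
  by (simp_all add: rel_algebra_def)

text \<open>The Brandt monoid \<open>B\<^sub>2\<^sup>1\<close> acting on two points.\<close>

definition B21 :: "(bool \<times> bool) set set" where
  "B21 = insert Id (insert {} {{(c, d)} | c d. True})"

lemma single_valued_B21: "b \<in> B21 \<Longrightarrow> single_valued b"
  by (auto simp: B21_def single_valued_def)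

lemma singleton_in_B21: "{(c, d)} \<in> B21"
  by (auto simp: B21_def)

lemma algebra21_B21: "algebra21 (rel_algebra B21)"
proof -
  have "a O b \<in> B21" if ab: "a \<in> B21" "b \<in> B21" for a b
  proof (cases "a = Id \<or> b = Id \<or> a = {} \<or> b = {}")
    case True
    then show ?thesis using ab by (elim disjE) (simp_all add: B21_def)
  next
    case False
    then obtain c d c' d' where "a = {(c, d)}" "b = {(c', d')}" using ab by (auto simp only: B21_def)
    then have "a O b = (if d = c' then {(c, d')} else {})" by auto
    then show ?thesis by (simp add: B21_def)
  qed
  moreover have "a\<inverse> \<in> B21" if a: "a \<in> B21" for a
  proof -
    consider "a = Id" | "a = {}" | c d where "a = {(c, d)}" using a by (auto simp only: B21_def)
    then show ?thesis
    proof cases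
      case (3 c d)
      then have "a\<inverse> = {(d, c)}" by auto
      then show ?thesis by (rule ssubst) (rule singleton_in_B21)
    qed (simp_all add: B21_def)
  qed
  moreover have "B21 \<noteq> {}" by (auto simp: B21_def)
  ultimately show ?thesis by (simp add: algebra21_def)
qed

primrec vars21 :: "term21 \<Rightarrow> nat set" where
  "vars21 (Var i) = {i}"
| "vars21 (Mul s t) = vars21 s \<union> vars21 t"
| "vars21 (Star t) = vars21 t"

lemma finite_vars21: "finite (vars21 t)"
  by (induction t) auto

lemma eval21_rel_mono:
  assumes "\<And>i x y. i \<in> vars21 t \<Longrightarrow> (x, y) \<in> a i \<Longrightarrow> (f x, f y) \<in> b i"
    and "(x, y) \<in> eval21 (rel_algebra C) a t"
  shows "(f x, f y) \<in> eval21 (rel_algebra D) b t"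
  using assms
proof (induction t arbitrary: x y)
  case (Mul s t)
  from Mul.prems(2) obtain z where "(x, z) \<in> eval21 (rel_algebra C) a s" "(z, y) \<in> eval21 (rel_algebra C) a t"
    by auto
  then have "(f x, f z) \<in> eval21 (rel_algebra D) b s" "(f z, f y) \<in> eval21 (rel_algebra D) b t"
    using Mul by auto
  then show ?case by auto
qed auto

context block_sequence
begin

lemma algebra21_Jumps: "algebra21 (rel_algebra (Jumps l))"
  using relcomp_Jumps converse_Jumps by (auto simp: algebra21_def Jumps_def)

section \<open>Two-colourings as simulations in the Brandt monoid\<close>

definition simulates :: "nat \<Rightarrow> (nat \<Rightarrow> (nat \<times> nat) set) \<Rightarrow> (nat \<Rightarrow> bool) \<Rightarrow> (nat \<Rightarrow> (bool \<times> bool) set) \<Rightarrow> bool" where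
  "simulates n a f b \<longleftrightarrow> range b \<subseteq> B21 \<and> (\<forall>i<n. \<forall>(x, y)\<in>a i. (f x, f y) \<in> b i)"

text \<open>The witness is the image of \<open>a\<close> if that has at most one element, and the identity otherwise.\<close>

lemma image_relation:
  assumes "(\<exists>c c'. \<forall>(x, y)\<in>a. f x = c \<and> f y = c') \<or> (\<forall>(x, y)\<in>a. f x = f y)"
  shows "\<exists>r. r \<in> B21 \<and> (\<forall>(x, y)\<in>a. (f x, f y) \<in> r) \<and>
      (\<forall>c t. (\<forall>x\<in>Domain a. f x = c) \<longrightarrow> f t \<noteq> c \<longrightarrow> f t \<notin> Domain r) \<and>
      (\<forall>c t. (\<forall>x\<in>Range a. f x = c) \<longrightarrow> f t \<noteq> c \<longrightarrow> f t \<notin> Range r)"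
proof (cases "\<exists>c c'. \<forall>(x, y)\<in>a. f x = c \<and> f y = c'")
  case True
  then obtain c c' where "\<forall>(x, y)\<in>a. f x = c \<and> f y = c'" by (elim exE)
  then have c: "\<And>x y. (x, y) \<in> a \<Longrightarrow> f x = c \<and> f y = c'" by auto
  show ?thesis
  proof (cases "a = {}")
    case False
    then have "c = d" if "\<forall>x\<in>Domain a. f x = d" for d using c that by fastforce
    moreover have "c' = d" if "\<forall>x\<in>Range a. f x = d" for d using c that False by fastforce
    ultimately show ?thesis using c singleton_in_B21 by (intro exI[of _ "{(c, c')}"]) auto
  qed (auto simp: B21_def intro!: exI[of _ "{}"])
next
  case False
  then have "\<forall>(x, y)\<in>a. f x = f y" using assms by argo
  then have eq: "\<And>x y. (x, y) \<in> a \<Longrightarrow> f x = f y" by auto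
  have ex: "\<exists>x y. (x, y) \<in> a \<and> f x \<noteq> c" for c
  proof (rule ccontr)
    assume "\<nexists>x y. (x, y) \<in> a \<and> f x \<noteq> c"
    then have "\<forall>(x, y)\<in>a. f x = c \<and> f y = c" using eq by auto
    then show False using False by blast
  qed
  have no: "\<not> (\<forall>x\<in>Domain a. f x = c) \<and> \<not> (\<forall>x\<in>Range a. f x = c)" for c
  proof -
    obtain x y where "(x, y) \<in> a" "f x \<noteq> c" using ex[of c] by (elim exE conjE)
    then show ?thesis using eq[of x y] by (intro conjI notI) (drule bspec, blast, simp)+
  qed
  show ?thesis
  proof (intro exI conjI)
    show "Id \<in> B21" by (simp add: B21_def)
    show "\<forall>(x, y)\<in>a. (f x, f y) \<in> Id" using eq by auto
  qed (simp_all only: no simp_thms)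
qed

lemma simulation_of_good:
  assumes "\<And>i. i < n \<Longrightarrow> a i = {} \<or> (\<exists>\<alpha> s s'. a i = jump l \<alpha> s s' \<and> good l \<alpha> f \<and>
      s \<le> M ^ (l - length \<alpha>) \<and> s' \<le> M ^ (l - length \<alpha>))"
  obtains b where "simulates n a f b"
    "\<And>i c t. i < n \<Longrightarrow> \<forall>x\<in>Domain (a i). f x = c \<Longrightarrow> f t \<noteq> c \<Longrightarrow> f t \<notin> Domain (b i)"
    "\<And>i c t. i < n \<Longrightarrow> \<forall>x\<in>Range (a i). f x = c \<Longrightarrow> f t \<noteq> c \<Longrightarrow> f t \<notin> Range (b i)"
proof -
  define fits where "fits i r \<longleftrightarrow> r \<in> B21 \<and> (\<forall>(x, y)\<in>a i. (f x, f y) \<in> r) \<and>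
      (\<forall>c t. (\<forall>x\<in>Domain (a i). f x = c) \<longrightarrow> f t \<noteq> c \<longrightarrow> f t \<notin> Domain r) \<and>
      (\<forall>c t. (\<forall>x\<in>Range (a i). f x = c) \<longrightarrow> f t \<noteq> c \<longrightarrow> f t \<notin> Range r)" for i r
  have "\<exists>r. fits i r" if "i < n" for i
  proof -
    have "(\<exists>c c'. \<forall>(x, y)\<in>a i. f x = c \<and> f y = c') \<or> (\<forall>(x, y)\<in>a i. f x = f y)"
      using assms[OF that]
    proof (elim disjE exE conjE)
      fix \<alpha> s s'
      assume "a i = jump l \<alpha> s s'" "good l \<alpha> f" "s \<le> M ^ (l - length \<alpha>)" "s' \<le> M ^ (l - length \<alpha>)"
      then show ?thesis using uniform_jump[of l \<alpha> f s s'] by simp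
    qed simp
    then show ?thesis unfolding fits_def by (rule image_relation)
  qed
  then obtain r where r: "\<And>i. i < n \<Longrightarrow> fits i (r i)" by metis
  define b where "b i = (if i < n then r i else {})" for i
  have b: "fits i (b i)" if "i < n" for i using r that by (simp add: b_def)
  show thesis
  proof (rule that)
    have "b i \<in> B21" for i
      using b[of i] by (cases "i < n") (simp_all add: fits_def b_def B21_def)
    moreover have "\<forall>(x, y)\<in>a i. (f x, f y) \<in> b i" if "i < n" for i
      using b[OF that] unfolding fits_def by (elim conjE)
    ultimately show "simulates n a f b" unfolding simulates_def by auto
    fix i c t
    assume i: "i < n" and t: "f t \<noteq> c"
    { assume c: "\<forall>x\<in>Domain (a i). f x = c"
      show "f t \<notin> Domain (b i)"
        by (rule b[OF i, unfolded fits_def, THEN conjunct2, THEN conjunct2, THEN conjunct1,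
              THEN spec, THEN spec, THEN mp, THEN mp, OF c t]) }
    { assume c: "\<forall>x\<in>Range (a i). f x = c"
      show "f t \<notin> Range (b i)"
        by (rule b[OF i, unfolded fits_def, THEN conjunct2, THEN conjunct2, THEN conjunct2,
              THEN spec, THEN spec, THEN mp, THEN mp, OF c t]) }
  qed
qed

lemma simulation_eval:
  assumes "simulates n a f b" "vars21 t \<subseteq> {..<n}" "(x, y) \<in> eval21 (rel_algebra C) a t"
  shows "(f x, f y) \<in> eval21 (rel_algebra B21) b t"
  by (rule eval21_rel_mono[OF _ assms(3)]) (use assms in \<open>auto simp: simulates_def\<close>)

lemma single_valued_simulation:
  assumes "simulates n a f b"
  shows "single_valued (eval21 (rel_algebra B21) b t)" "single_valued ((eval21 (rel_algebra B21) b t)\<inverse>)"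
proof -
  have "eval21 (rel_algebra B21) b t' \<in> B21" for t'
    using eval21_closed[OF algebra21_B21, of b] assms by (simp add: simulates_def)
  from this[of t] this[of "Star t"] show "single_valued (eval21 (rel_algebra B21) b t)"
    "single_valued ((eval21 (rel_algebra B21) b t)\<inverse>)"
    using single_valued_B21 by auto
qed

text \<open>The first \<open>k\<close> elements have at most \<open>k\<close> addresses, so
  \<open>separation\<close> applies. A colour that is constant on the domain or range of
  \<open>a i\<close> and differs at \<open>t\<close> keeps \<open>f t\<close> out of that of
  \<open>b i\<close>.\<close>

lemma separating_simulations:
  assumes a: "range a \<subseteq> Jumps l"
  shows "i < k \<Longrightarrow> t \<le> M ^ l \<Longrightarrow> t \<notin> Domain (a i) \<Longrightarrow> \<exists>f b. simulates k a f b \<and> f t \<notin> Domain (b i)"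
    and "i < k \<Longrightarrow> t \<le> M ^ l \<Longrightarrow> t \<notin> Range (a i) \<Longrightarrow> \<exists>f b. simulates k a f b \<and> f t \<notin> Range (b i)"
    and "s \<le> M ^ l \<Longrightarrow> t \<le> M ^ l \<Longrightarrow> s \<noteq> t \<Longrightarrow> \<exists>f b. simulates k a f b \<and> f s \<noteq> f t"
proof -
  have "\<exists>\<alpha> s s'. a i = {} \<or> a i = jump l \<alpha> s s' \<and> s \<le> M ^ (l - length \<alpha>) \<and> s' \<le> M ^ (l - length \<alpha>)" for i
    using a Jumps_cases[of "a i" l] by (metis range_subsetD)
  then obtain ad s s' where ad: "\<And>i. a i = {} \<or> a i = jump l (ad i) (s i) (s' i) \<and>
      s i \<le> M ^ (l - length (ad i)) \<and> s' i \<le> M ^ (l - length (ad i))"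
    by metis
  define A where "A = ad ` {..<k}"
  have A: "finite A" "card A \<le> k" unfolding A_def using card_image_le[of "{..<k}" ad] by auto
  have sim: "\<exists>b. simulates k a f b \<and>
      (\<forall>i c t. i < k \<longrightarrow> (\<forall>x\<in>Domain (a i). f x = c) \<longrightarrow> f t \<noteq> c \<longrightarrow> f t \<notin> Domain (b i)) \<and>
      (\<forall>i c t. i < k \<longrightarrow> (\<forall>x\<in>Range (a i). f x = c) \<longrightarrow> f t \<noteq> c \<longrightarrow> f t \<notin> Range (b i))"
    if "\<forall>\<beta>\<in>A. good l \<beta> f" for f
  proof (rule simulation_of_good[of k a l f])
    show "a i = {} \<or> (\<exists>\<alpha> s s'. a i = jump l \<alpha> s s' \<and> good l \<alpha> f \<and>
      s \<le> M ^ (l - length \<alpha>) \<and> s' \<le> M ^ (l - length \<alpha>))" if "i < k" for i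
      using ad[of i] that \<open>\<forall>\<beta>\<in>A. good l \<beta> f\<close> unfolding A_def by blast
  qed blast
  have triv: "good l \<alpha> (\<lambda>_. True)" for \<alpha>
    by (induction l \<alpha> "\<lambda>_::nat. True" rule: good.induct) auto
  have sep: "\<exists>f c. (\<forall>\<beta>\<in>A. good l \<beta> f) \<and> (\<forall>d\<in>positions l (ad i) u. f d = c) \<and> f t \<noteq> c"
    if "i < k" "t \<le> M ^ l" "t \<notin> positions l (ad i) u" "u \<le> M ^ (l - length (ad i))" for i t u
    using separation[OF A, of "ad i" u l t] that by (auto simp: A_def)
  have sepD: "\<exists>f c. (\<forall>\<beta>\<in>A. good l \<beta> f) \<and> (\<forall>d\<in>Domain (a i). f d = c) \<and> f t \<noteq> c"
    if "i < k" "t \<le> M ^ l" "t \<notin> Domain (a i)" for i t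
  proof (cases "a i = {}")
    case True
    then show ?thesis using triv by (intro exI[of _ "\<lambda>_. True"] exI[of _ False]) auto
  next
    case False
    then show ?thesis using sep[of i t "s i"] ad[of i] that by (auto simp: Domain_jump)
  qed
  have sepR: "\<exists>f c. (\<forall>\<beta>\<in>A. good l \<beta> f) \<and> (\<forall>d\<in>Range (a i). f d = c) \<and> f t \<noteq> c"
    if "i < k" "t \<le> M ^ l" "t \<notin> Range (a i)" for i t
  proof (cases "a i = {}")
    case True
    then show ?thesis using triv by (intro exI[of _ "\<lambda>_. True"] exI[of _ False]) auto
  next
    case False
    then show ?thesis using sep[of i t "s' i"] ad[of i] that by (auto simp: Range_jump)
  qed
  show "\<exists>f b. simulates k a f b \<and> f t \<notin> Domain (b i)" if it: "i < k" "t \<le> M ^ l" "t \<notin> Domain (a i)"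
  proof -
    obtain f c where f: "\<forall>\<beta>\<in>A. good l \<beta> f" "\<forall>d\<in>Domain (a i). f d = c" "f t \<noteq> c"
      using sepD[OF it] by (elim exE conjE)
    obtain b where b: "simulates k a f b" and
      H: "\<forall>i c t. i < k \<longrightarrow> (\<forall>x\<in>Domain (a i). f x = c) \<longrightarrow> f t \<noteq> c \<longrightarrow> f t \<notin> Domain (b i)"
      using sim[OF f(1)] by (elim exE conjE)
    have "f t \<notin> Domain (b i)"
      by (rule H[THEN spec, THEN spec, THEN spec, THEN mp, THEN mp, THEN mp, OF it(1) f(2,3)])
    then show ?thesis using b by (intro exI conjI)
  qed
  show "\<exists>f b. simulates k a f b \<and> f t \<notin> Range (b i)" if it: "i < k" "t \<le> M ^ l" "t \<notin> Range (a i)"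
  proof -
    obtain f c where f: "\<forall>\<beta>\<in>A. good l \<beta> f" "\<forall>d\<in>Range (a i). f d = c" "f t \<noteq> c"
      using sepR[OF it] by (elim exE conjE)
    obtain b where b: "simulates k a f b" and
      H: "\<forall>i c t. i < k \<longrightarrow> (\<forall>x\<in>Range (a i). f x = c) \<longrightarrow> f t \<noteq> c \<longrightarrow> f t \<notin> Range (b i)"
      using sim[OF f(1)] by (elim exE conjE)
    have "f t \<notin> Range (b i)"
      by (rule H[THEN spec, THEN spec, THEN spec, THEN mp, THEN mp, THEN mp, OF it(1) f(2,3)])
    then show ?thesis using b by (intro exI conjI)
  qed
  show "\<exists>f b. simulates k a f b \<and> f s \<noteq> f t" if "s \<le> M ^ l" "t \<le> M ^ l" "s \<noteq> t" for s t
  proof -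
    have "\<exists>f c. (\<forall>\<beta>\<in>A. good l \<beta> f) \<and> (\<forall>d\<in>positions l [] s. f d = c) \<and> f t \<noteq> c"
      using separation[OF A, of "[]" s l t] that by auto
    then obtain f where f: "\<forall>\<beta>\<in>A. good l \<beta> f" "f s \<noteq> f t" by auto
    obtain b where "simulates k a f b" using sim[OF f(1)] by (elim exE conjE)
    then show ?thesis using f(2) by (intro exI conjI)
  qed
qed

text \<open>Domain and range go together because \<open>Star\<close> exchanges them. If a product is
  undefined at \<open>p\<close> only because its second factor is undefined at the intermediate
  point \<open>q\<close>, a simulation for \<open>q\<close> also serves for \<open>p\<close>: the
  simulated first factor is single-valued and takes \<open>f p\<close> to \<open>f q\<close>. Ranges
  are dual.\<close>

lemma defined_or_separated:
  assumes a: "range a \<subseteq> Jumps l" and t: "vars21 t \<subseteq> {..<k}" and p: "p \<le> M ^ l"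
  shows "p \<in> Domain (eval21 (rel_algebra (Jumps l)) a t) \<or>
      (\<exists>f b. simulates k a f b \<and> f p \<notin> Domain (eval21 (rel_algebra B21) b t))"
    and "p \<in> Range (eval21 (rel_algebra (Jumps l)) a t) \<or>
      (\<exists>f b. simulates k a f b \<and> f p \<notin> Range (eval21 (rel_algebra B21) b t))"
  using t p
proof (induction t arbitrary: p)
  case (Var i)
  {
    case 1
    then show ?case using separating_simulations(1)[OF a, of i p] by auto
  next
    case 2
    then show ?case using separating_simulations(2)[OF a, of i p] by auto
  }
next
  case (Mul s t)
  have vs: "vars21 s \<subseteq> {..<k}" "vars21 t \<subseteq> {..<k}" if "vars21 (Mul s t) \<subseteq> {..<k}" using that by auto
  have le: "eval21 (rel_algebra (Jumps l)) a u \<subseteq> {..M ^ l} \<times> {..M ^ l}" for u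
    using Jumps_le eval21_closed[OF algebra21_Jumps, of a l] a by simp
  {
    case 1
    note v = vs[OF 1(1)]
    show ?case
    proof (cases "p \<in> Domain (eval21 (rel_algebra (Jumps l)) a s)")
      case False
      then obtain f b where "simulates k a f b" "f p \<notin> Domain (eval21 (rel_algebra B21) b s)"
        using Mul(1)[OF v(1) 1(2)] by blast
      then show ?thesis by (intro disjI2 exI[of _ f] exI[of _ b]) auto
    next
      case True
      then obtain q where q: "(p, q) \<in> eval21 (rel_algebra (Jumps l)) a s" by blast
      then have ql: "q \<le> M ^ l" using le by blast
      show ?thesis
      proof (cases "q \<in> Domain (eval21 (rel_algebra (Jumps l)) a t)")
        case False
        then obtain f b where fb: "simulates k a f b" "f q \<notin> Domain (eval21 (rel_algebra B21) b t)"
          using Mul(3)[OF v(2) ql] by blast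
        have "(f p, f q) \<in> eval21 (rel_algebra B21) b s" using simulation_eval[OF fb(1) v(1) q] .
        then have "f p \<notin> Domain (eval21 (rel_algebra B21) b (Mul s t))"
          using fb(2) single_valued_simulation(1)[OF fb(1), of s] by (auto dest: single_valuedD)
        then show ?thesis using fb(1) by blast
      qed (use q in auto)
    qed
  next
    case 2
    note v = vs[OF 2(1)]
    show ?case
    proof (cases "p \<in> Range (eval21 (rel_algebra (Jumps l)) a t)")
      case False
      then obtain f b where "simulates k a f b" "f p \<notin> Range (eval21 (rel_algebra B21) b t)"
        using Mul(4)[OF v(2) 2(2)] by blast
      then show ?thesis by (intro disjI2 exI[of _ f] exI[of _ b]) auto
    next
      case True
      then obtain q where q: "(q, p) \<in> eval21 (rel_algebra (Jumps l)) a t" by blast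
      then have ql: "q \<le> M ^ l" using le by blast
      show ?thesis
      proof (cases "q \<in> Range (eval21 (rel_algebra (Jumps l)) a s)")
        case False
        then obtain f b where fb: "simulates k a f b" "f q \<notin> Range (eval21 (rel_algebra B21) b s)"
          using Mul(2)[OF v(1) ql] by blast
        have "(f q, f p) \<in> eval21 (rel_algebra B21) b t" using simulation_eval[OF fb(1) v(2) q] .
        then have "f p \<notin> Range (eval21 (rel_algebra B21) b (Mul s t))"
          using fb(2) single_valued_simulation(2)[OF fb(1), of t]
          by (auto dest: single_valuedD simp: Range_iff)
        then show ?thesis using fb(1) by blast
      qed (use q in auto)
    qed
  }
next
  case (Star t)
  { case 1 then show ?case using Star(2)[of p] by auto next
    case 2 then show ?case using Star(1)[of p] by auto }
qed

text \<open>Simulations detect whether \<open>w\<close> is defined at \<open>p\<close> and where it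
  leads. By the identity none of them contradicts \<open>(p, q)\<close>, so \<open>w\<close> is
  defined at \<open>p\<close>, and its image there cannot be separated from
  \<open>q\<close>.\<close>

lemma transfer_le:
  assumes a: "range a \<subseteq> Jumps l" and vars: "vars21 u \<subseteq> {..<k}" "vars21 w \<subseteq> {..<k}"
    and sat: "satisfies (rel_algebra B21) (u, w)"
  shows "eval21 (rel_algebra (Jumps l)) a u \<subseteq> eval21 (rel_algebra (Jumps l)) a w"
proof (rule subrelI)
  fix p q assume pq: "(p, q) \<in> eval21 (rel_algebra (Jumps l)) a u"
  have le: "eval21 (rel_algebra (Jumps l)) a u \<subseteq> {..M ^ l} \<times> {..M ^ l}" for u
    using Jumps_le eval21_closed[OF algebra21_Jumps, of a l] a by simp
  have eq: "eval21 (rel_algebra B21) b u = eval21 (rel_algebra B21) b w" if "simulates k a f b" for f b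
    using sat that by (simp add: satisfies_def simulates_def)
  have sim: "(f p, f q) \<in> eval21 (rel_algebra B21) b w" if "simulates k a f b" for f b
    using simulation_eval[OF that vars(1) pq] eq[OF that] by simp
  have "p \<le> M ^ l" using le pq by blast
  then obtain q' where q': "(p, q') \<in> eval21 (rel_algebra (Jumps l)) a w"
    using defined_or_separated(1)[OF a vars(2), of p] sim by blast
  have "f q = f q'" if "simulates k a f b" for f b
    by (rule single_valuedD[OF single_valued_simulation(1)[OF that]
          sim[OF that] simulation_eval[OF that vars(2) q']])
  moreover have "q \<le> M ^ l" "q' \<le> M ^ l" using le pq q' by blast+
  ultimately have "q = q'" using separating_simulations(3)[OF a] by blast
  then show "(p, q) \<in> eval21 (rel_algebra (Jumps l)) a w" using q' by simp
qed

lemma satisfies_Jumps: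
  assumes "vars21 (fst e) \<subseteq> {..<k}" "vars21 (snd e) \<subseteq> {..<k}" and "satisfies (rel_algebra B21) e"
  shows "satisfies (rel_algebra (Jumps l)) e"
proof -
  have "satisfies (rel_algebra B21) (snd e, fst e)" "satisfies (rel_algebra B21) (fst e, snd e)"
    using assms(3) by (auto simp: satisfies_def)
  then show ?thesis using transfer_le assms(1,2) unfolding satisfies_def by (intro allI impI equalityI) auto
qed

end

section \<open>The Brandt monoid inside a power semigroup\<close>

abbreviation (input) "Pow21 \<equiv> power_involution_semigroup"

lemma Pow21_simps [simp]:
  "carrier (Pow21 G) = Pow (carrier G)" "mul (Pow21 G) A B = A <#>\<^bsub>G\<^esub> B" "star (Pow21 G) A = set_inv\<^bsub>G\<^esub> A"
  by (simp_all add: power_involution_semigroup_def)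

lemma (in group) algebra21_Pow21: "algebra21 (Pow21 G)"
  using involution_semigroup_power[OF group_axioms] by (simp add: involution_semigroup_def)

lemma (in group) card_r_coset: "A \<subseteq> carrier G \<Longrightarrow> x \<in> carrier G \<Longrightarrow> card (A #> x) = card A"
  using card_image[of "\<lambda>a. a \<otimes> x" A] by (auto simp: r_coset_def inj_on_def UNION_singleton_eq_range subset_iff)

lemma (in group) card_set_mult_left:
  assumes "finite (carrier G)" "A \<subseteq> carrier G" "B \<subseteq> carrier G" "B \<noteq> {}"
  shows "card A \<le> card (A <#> B)"
proof -
  obtain b where b: "b \<in> B" using assms(4) by blast
  have "A #> b \<subseteq> A <#> B" using b by (auto simp: r_coset_def set_mult_def)
  then have "card (A #> b) \<le> card (A <#> B)"
    using assms set_mult_closed by (meson card_mono finite_subset)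
  then show ?thesis using card_r_coset assms b by auto
qed

lemma (in group) card_set_inv: "A \<subseteq> carrier G \<Longrightarrow> card (set_inv A) = card A"
proof -
  assume "A \<subseteq> carrier G"
  then have "inj_on (\<lambda>a. inv a) A" by (intro inj_onI) (metis inv_inv subsetD)
  moreover have "set_inv A = (\<lambda>a. inv a) ` A" by (auto simp: SET_INV_def)
  ultimately show ?thesis by (simp add: card_image)
qed

lemma (in group) set_inv_closed: "A \<subseteq> carrier G \<Longrightarrow> set_inv A \<subseteq> carrier G"
  by (auto simp: SET_INV_def)

lemma (in group) set_inv_mult:
  "A \<subseteq> carrier G \<Longrightarrow> B \<subseteq> carrier G \<Longrightarrow> set_inv (A <#> B) = set_inv B <#> set_inv A"
  using involution_semigroup_power[OF group_axioms] by (simp add: involution_semigroup_def)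

lemma (in group) card_set_mult_right:
  assumes "finite (carrier G)" "A \<subseteq> carrier G" "B \<subseteq> carrier G" "A \<noteq> {}"
  shows "card B \<le> card (A <#> B)"
proof -
  have "card (set_inv B) \<le> card (set_inv B <#> set_inv A)"
    using assms by (intro card_set_mult_left set_inv_closed) (auto simp: SET_INV_def)
  also have "\<dots> = card (A <#> B)"
    using assms by (simp flip: set_inv_mult add: card_set_inv set_mult_closed)
  finally show ?thesis using assms by (simp add: card_set_inv)
qed

locale non_normal = group G for G (structure) +
  fixes H :: "'a set" and g :: 'a
  assumes fin: "finite (carrier G)" and H: "subgroup H G" and g: "g \<in> carrier G"
    and not_normal: "\<exists>h\<in>H. g \<otimes> h \<otimes> inv g \<notin> H"
begin

definition rep :: "bool \<Rightarrow> 'a" where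
  "rep c = (if c then g else \<one>)"

text \<open>The indices are chosen so that these translates of \<open>H\<close> multiply like the
  matrix units \<open>{(c, d)}\<close>.\<close>

definition brick :: "bool \<Rightarrow> bool \<Rightarrow> 'a set" where
  "brick c d = (\<lambda>h. inv (rep c) \<otimes> h \<otimes> rep d) ` H"

lemma rep_closed [simp]: "rep c \<in> carrier G"
  using g by (simp add: rep_def)

lemma mem_H_closed [simp]: "h \<in> H \<Longrightarrow> h \<in> carrier G"
  using H subgroup.mem_carrier by metis

lemma finite_H: "finite H"
  using fin H finite_subset subgroup.subset by blast

lemma brick_closed: "brick c d \<subseteq> carrier G"
  by (auto simp: brick_def)

lemma card_brick: "card (brick c d) = card H"
  unfolding brick_def by (rule card_image) (auto simp: inj_on_def)

text \<open>By finiteness, a conjugate of \<open>H\<close> contained in \<open>H\<close> equals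
  \<open>H\<close>, and the inclusion can be reversed.\<close>

lemma not_normal_inv: "\<exists>h\<in>H. inv g \<otimes> h \<otimes> g \<notin> H"
proof (rule ccontr)
  assume neg: "\<not> ?thesis"
  have "(\<lambda>h. inv g \<otimes> h \<otimes> g) ` H = H"
  proof (rule card_subset_eq[OF finite_H])
    show "(\<lambda>h. inv g \<otimes> h \<otimes> g) ` H \<subseteq> H" using neg by blast
    show "card ((\<lambda>h. inv g \<otimes> h \<otimes> g) ` H) = card H"
      by (rule card_image) (use g in \<open>auto simp: inj_on_def\<close>)
  qed
  moreover obtain h where h: "h \<in> H" "g \<otimes> h \<otimes> inv g \<notin> H" using not_normal by blast
  ultimately obtain h' where h': "h' \<in> H" "h = inv g \<otimes> h' \<otimes> g" by blast
  have "g \<otimes> (inv g \<otimes> h') = h'" using h' g by (simp flip: m_assoc)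
  then have "g \<otimes> h \<otimes> inv g = h'" unfolding h'(2) using h' g by (simp add: m_assoc)
  then show False using h h' by simp
qed

lemma rep_not_normal:
  assumes "c \<noteq> d"
  shows "\<exists>h\<in>H. rep c \<otimes> inv (rep d) \<otimes> h \<otimes> inv (rep c \<otimes> inv (rep d)) \<notin> H"
  using assms not_normal not_normal_inv g by (cases c; cases d) (simp_all add: rep_def)

text \<open>This lets the size distinguish \<open>{\<one>}\<close> from the bricks.\<close>

lemma card_H_gt_1: "1 < card H"
proof (rule ccontr)
  assume "\<not> 1 < card H"
  then have "card H = 1" using subgroup.one_closed[OF H] finite_H by (metis card_0_eq empty_iff linorder_neqE_nat less_one)
  then obtain x where "H = {x}" by (rule card_1_singletonE)
  then have "H = {\<one>}" using subgroup.one_closed[OF H] by simp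
  then show False using not_normal g by simp
qed

lemma set_inv_brick: "set_inv (brick c d) = brick d c"
proof -
  have "inv (inv (rep c) \<otimes> h \<otimes> rep d) = inv (rep d) \<otimes> inv h \<otimes> rep c" if "h \<in> H" for h c d
    using that by (simp add: inv_mult_group m_assoc)
  then have sub: "set_inv (brick c d) \<subseteq> brick d c" for c d
    using subgroup.m_inv_closed[OF H] unfolding SET_INV_def brick_def by fastforce
  show ?thesis
  proof (rule card_subset_eq)
    show "finite (brick d c)" using finite_subset[OF brick_closed fin] .
    show "card (set_inv (brick c d)) = card (brick d c)"
      by (simp add: card_set_inv brick_closed card_brick)
  qed (rule sub)
qed

lemma brick_mult: "brick c d <#> brick d e = brick c e"
proof
  have eq: "(inv (rep c) \<otimes> h \<otimes> rep d) \<otimes> (inv (rep d) \<otimes> h' \<otimes> rep e) = inv (rep c) \<otimes> (h \<otimes> h') \<otimes> rep e"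
    if "h \<in> H" "h' \<in> H" for h h'
  proof -
    have "rep d \<otimes> (inv (rep d) \<otimes> (h' \<otimes> rep e)) = h' \<otimes> rep e"
      using that by (simp flip: m_assoc)
    then show ?thesis using that by (simp add: m_assoc)
  qed
  show "brick c d <#> brick d e \<subseteq> brick c e"
  proof
    fix x assume "x \<in> brick c d <#> brick d e"
    then obtain h h' where "h \<in> H" "h' \<in> H" "x = (inv (rep c) \<otimes> h \<otimes> rep d) \<otimes> (inv (rep d) \<otimes> h' \<otimes> rep e)"
      by (auto simp: set_mult_def brick_def)
    then show "x \<in> brick c e"
      using eq[of h h'] subgroup.m_closed[OF H, of h h'] by (simp add: brick_def)
  qed
  show "brick c e \<subseteq> brick c d <#> brick d e"
  proof
    fix x assume "x \<in> brick c e"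
    then obtain h where h: "h \<in> H" "x = inv (rep c) \<otimes> h \<otimes> rep e" by (auto simp: brick_def)
    have "x = (inv (rep c) \<otimes> h \<otimes> rep d) \<otimes> (inv (rep d) \<otimes> \<one> \<otimes> rep e)"
      using eq[of h \<one>] h subgroup.one_closed[OF H] by simp
    then show "x \<in> brick c d <#> brick d e"
      unfolding set_mult_def brick_def using h(1) subgroup.one_closed[OF H] by blast
  qed
qed

text \<open>The product is a union of right translates of \<open>brick c d\<close>, each of size
  \<open>card H\<close>. If it were no larger, all of them would coincide, and comparing two shows
  that \<open>rep d \<otimes> inv (rep d')\<close> conjugates \<open>H\<close> into itself.\<close>

lemma brick_mult_big:
  assumes "d \<noteq> d'"
  shows "card H < card (brick c d <#> brick d' e)"
proof (rule ccontr)
  assume neg: "\<not> ?thesis"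
  let ?z = "rep d \<otimes> inv (rep d')" and ?P = "brick c d <#> brick d' e"
  have z: "?z \<in> carrier G" by simp
  have fP: "finite ?P"
    using finite_subset[OF set_mult_closed[OF brick_closed brick_closed] fin] .
  have coset: "brick c d #> y = ?P" if y: "y \<in> brick d' e" for y
  proof (rule card_subset_eq[OF fP])
    show sub: "brick c d #> y \<subseteq> ?P" using y by (auto simp: r_coset_def set_mult_def)
    have "card (brick c d #> y) = card H"
      using card_r_coset brick_closed y card_brick by (metis subsetD)
    then show "card (brick c d #> y) = card ?P"
      using neg card_mono[OF fP sub] by simp
  qed
  obtain h where h: "h \<in> H" "?z \<otimes> h \<otimes> inv ?z \<notin> H" using rep_not_normal[OF assms] by blast
  have one: "\<one> \<in> H" using subgroup.one_closed[OF H] .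
  have y: "inv (rep d') \<otimes> h \<otimes> rep e \<in> brick d' e" "inv (rep d') \<otimes> \<one> \<otimes> rep e \<in> brick d' e"
    unfolding brick_def using h(1) one by blast+
  have "inv (rep c) \<otimes> \<one> \<otimes> rep d \<in> brick c d" unfolding brick_def using one by (rule imageI)
  then have "(inv (rep c) \<otimes> \<one> \<otimes> rep d) \<otimes> (inv (rep d') \<otimes> h \<otimes> rep e) \<in> brick c d #> (inv (rep d') \<otimes> \<one> \<otimes> rep e)"
    using coset[OF y(1)] coset[OF y(2)] unfolding r_coset_def by blast
  then obtain h' where h': "h' \<in> H" "(inv (rep c) \<otimes> \<one> \<otimes> rep d) \<otimes> (inv (rep d') \<otimes> h \<otimes> rep e)
      = (inv (rep c) \<otimes> h' \<otimes> rep d) \<otimes> (inv (rep d') \<otimes> \<one> \<otimes> rep e)"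
    by (auto simp: r_coset_def brick_def)
  have "inv (rep c) \<otimes> (?z \<otimes> h \<otimes> rep e) = inv (rep c) \<otimes> (h' \<otimes> ?z \<otimes> rep e)"
    using h' h by (simp add: m_assoc)
  then have "?z \<otimes> h \<otimes> rep e = h' \<otimes> ?z \<otimes> rep e" using h h' by simp
  then have "?z \<otimes> h = h' \<otimes> ?z" using h h' by simp
  then have "?z \<otimes> h \<otimes> inv ?z = h'" using h h' z by (simp add: inv_solve_right')
  then show False using h h' by simp
qed

text \<open>Equal bricks with different indices would give a product that is large by
  \<open>brick_mult_big\<close> but equals \<open>brick d d\<close> or
  \<open>brick c c\<close>.\<close>

lemma brick_eqD:
  assumes "brick c d = brick c' d'"
  shows "c = c' \<and> d = d'"
proof -
  have "brick d c <#> brick c' d' = brick d d" "brick c' d' <#> brick d c = brick c c"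
    using brick_mult assms by metis+
  then have "\<not> card H < card (brick d c <#> brick c' d')" "\<not> card H < card (brick c' d' <#> brick d c)"
    by (simp_all add: card_brick)
  then show ?thesis using brick_mult_big by metis
qed

text \<open>Relates subsets of \<open>G\<close> to elements of \<open>B\<^sub>2\<^sup>1\<close>. It is closed under products because the product
  of two non-composable bricks, and of a large set with any nonempty set, has more than \<open>card H\<close> elements.\<close>

definition represents :: "'a set \<Rightarrow> (bool \<times> bool) set \<Rightarrow> bool" where
  "represents A r \<longleftrightarrow> A \<subseteq> carrier G \<and> (r = Id \<and> A = {\<one>} \<or> (\<exists>c d. r = {(c, d)} \<and> A = brick c d) \<or>
     r = {} \<and> (A = {} \<or> card H < card A))"

lemma represents_cases:
  assumes "represents A r"
  obtains "r = Id" "A = {\<one>}" | c d where "r = {(c, d)}" "A = brick c d"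
    | "r = {}" "A = {}" | "r = {}" "card H < card A"
  using assms unfolding represents_def by blast

lemma represents_empty: "A \<subseteq> carrier G \<Longrightarrow> A = {} \<or> card H < card A \<Longrightarrow> represents A {}"
  by (simp add: represents_def)

lemma represents_mult:
  assumes "represents A r" "represents B s"
  shows "represents (A <#> B) (r O s)"
proof -
  have AB: "A \<subseteq> carrier G" "B \<subseteq> carrier G" using assms by (auto simp: represents_def)
  have closed: "A <#> B \<subseteq> carrier G" using set_mult_closed[OF AB] .
  have emp: "A <#> {} = {}" "{} <#> B = {}" by (auto simp: set_mult_def)
  have one: "A <#> {\<one>} = A" "{\<one>} <#> B = B"
    using AB by (auto simp: set_mult_def subset_iff)
  have big: "A <#> B = {} \<or> card H < card (A <#> B)" if "card H < card A \<or> card H < card B"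
    using that card_set_mult_left[OF fin AB] card_set_mult_right[OF fin AB] emp
    by (cases "A = {} \<or> B = {}") auto
  show ?thesis using assms(1)
  proof (cases rule: represents_cases)
    case 1
    then show ?thesis using assms(2) one by simp
  next
    case (2 c d)
    note A = 2
    show ?thesis using assms(2)
    proof (cases rule: represents_cases)
      case 1
      then show ?thesis using assms(1) one by simp
    next
      case (2 d' e)
      show ?thesis
      proof (cases "d = d'")
        case True
        then have "r O s = {(c, e)}" using A 2 by auto
        then show ?thesis using A 2 True brick_mult brick_closed by (auto simp: represents_def)
      next
        case False
        then have "r O s = {}" using A 2 by auto
        then show ?thesis using A 2 brick_mult_big[OF False] closed represents_empty by simp
      qed
    qed (use emp big closed represents_empty in simp_all)
  qed (use emp big closed represents_empty in simp_all)
qed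

lemma represents_inv:
  assumes "represents A r"
  shows "represents (set_inv A) (r\<inverse>)"
proof -
  have A: "A \<subseteq> carrier G" using assms by (auto simp: represents_def)
  show ?thesis using assms
  proof (cases rule: represents_cases)
    case (2 c d)
    then have "r\<inverse> = {(d, c)}" by auto
    then show ?thesis using 2 set_inv_brick brick_closed by (auto simp: represents_def)
  qed (use A in \<open>auto simp: represents_def SET_INV_def card_set_inv[unfolded SET_INV_def]\<close>)
qed

lemma represents_card:
  assumes "represents A r"
  shows "r = Id \<longleftrightarrow> card A = 1" and "r = {} \<longleftrightarrow> card A = 0 \<or> card H < card A"
proof -
  have ne1: "Id \<noteq> {(c, d)}" for c d :: bool
  proof
    assume *: "Id = {(c, d)}"
    have "(True, True) \<in> {(c, d)}" "(False, False) \<in> {(c, d)}" unfolding *[symmetric] by simp_all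
    then show False by simp
  qed
  have "(True, True) \<in> Id" by simp
  then have ne2: "(Id :: (bool \<times> bool) set) \<noteq> {}" by blast
  have "(r = Id \<longleftrightarrow> card A = 1) \<and> (r = {} \<longleftrightarrow> card A = 0 \<or> card H < card A)"
    using assms
  proof (cases rule: represents_cases)
    case 1
    then have "card A = 1" by simp
    then show ?thesis using 1(1) ne2 card_H_gt_1 by simp
  next
    case (2 c d)
    then have "card A = card H" by (simp only: card_brick)
    moreover have "r \<noteq> Id" "r \<noteq> {}" unfolding 2(1) using ne1[of c d] by (simp_all only: not_sym insert_not_empty simp_thms)
    ultimately show ?thesis using card_H_gt_1 by simp
  next
    case 3
    then show ?thesis using ne2[symmetric] by (simp only: card.empty) simp
  next
    case 4
    then have "card A \<noteq> 1" using card_H_gt_1 by simp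
    then show ?thesis using 4 ne2[symmetric] by (simp only: simp_thms)
  qed
  then show "r = Id \<longleftrightarrow> card A = 1" "r = {} \<longleftrightarrow> card A = 0 \<or> card H < card A" by blast+
qed

lemma represents_unique:
  assumes "represents A r" "represents A s"
  shows "r = s"
proof (cases "card A = 1 \<or> card A = 0 \<or> card H < card A")
  case True
  then show ?thesis using represents_card[OF assms(1)] represents_card[OF assms(2)] by blast
next
  case False
  have "\<exists>c d. t = {(c, d)} \<and> A = brick c d" if "represents A t" for t
    using represents_card[OF that] False by (cases rule: represents_cases[OF that]) blast+
  then obtain c d c' d' where "r = {(c, d)}" "A = brick c d" "s = {(c', d')}" "A = brick c' d'"
    using assms by meson
  then show ?thesis using brick_eqD[of c d c' d'] by simp
qed

lemma represents_eval:
  assumes "\<And>i. represents (A i) (b i)"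
  shows "represents (eval21 (Pow21 G) A t) (eval21 (rel_algebra B21) b t)"
  by (induction t) (simp_all add: assms represents_mult represents_inv)

lemma ex_represents:
  assumes "r \<in> B21"
  shows "\<exists>A. represents A r"
proof -
  consider "r = Id" | "r = {}" | c d where "r = {(c, d)}" using assms by (auto simp only: B21_def)
  then show ?thesis
  proof cases
    case 1
    then have "represents {\<one>} r" by (simp add: represents_def)
    then show ?thesis ..
  next
    case 2
    then have "represents {} r" by (simp add: represents_def)
    then show ?thesis ..
  next
    case (3 c d)
    then have "represents (brick c d) r" using brick_closed by (auto simp: represents_def)
    then show ?thesis ..
  qed
qed

text \<open>The relation \<open>represents\<close> is a homomorphism from a subalgebra of the power
  semigroup onto \<open>B21\<close>, and identities pass to such images.\<close>

lemma satisfies_B21: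
  assumes "satisfies (Pow21 G) e"
  shows "satisfies (rel_algebra B21) e"
  unfolding satisfies_def
proof (intro allI impI)
  fix b :: "nat \<Rightarrow> (bool \<times> bool) set"
  assume "range b \<subseteq> carrier (rel_algebra B21)"
  then have "\<forall>i. \<exists>A. represents A (b i)" using ex_represents by auto
  then obtain A where A: "\<And>i. represents (A i) (b i)" by metis
  then have "range A \<subseteq> carrier (Pow21 G)" by (auto simp: represents_def)
  then have eq: "eval21 (Pow21 G) A (fst e) = eval21 (Pow21 G) A (snd e)"
    using assms by (simp add: satisfies_def)
  show "eval21 (rel_algebra B21) b (fst e) = eval21 (rel_algebra B21) b (snd e)"
    using represents_eval[of A b "fst e", OF A] represents_eval[of A b "snd e", OF A] unfolding eq
    by (rule represents_unique)
qed

end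

section \<open>A law of power semigroups of solvable groups\<close>

primrec prod21 :: "(nat \<Rightarrow> term21) \<Rightarrow> nat \<Rightarrow> term21" where
  "prod21 f 0 = f 0"
| "prod21 f (Suc j) = Mul (prod21 f j) (f (Suc j))"

text \<open>Each address of length \<open>l\<close> has its own letter, named by \<open>r\<close>.
  As \<open>prod21\<close> has one factor more than its index, \<open>M - 1\<close> gives
  \<open>M\<close> blocks.\<close>

primrec word21 :: "nat \<Rightarrow> (nat \<Rightarrow> bool) \<Rightarrow> (nat \<Rightarrow> nat) \<Rightarrow> nat \<Rightarrow> (nat list \<Rightarrow> nat) \<Rightarrow> term21" where
  "word21 M pos child 0 r = Var (r [])"
| "word21 M pos child (Suc l) r = prod21 (\<lambda>q. let w = word21 M pos child l (\<lambda>\<alpha>. r (child q # \<alpha>))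
     in if pos q then w else Star w) (M - 1)"

definition group21 :: "('a, 'b) monoid_scheme \<Rightarrow> 'a alg21" where
  "group21 G = \<lparr>carrier = carrier G, mul = (\<otimes>\<^bsub>G\<^esub>), star = m_inv G\<rparr>"

lemma group21_simps [simp]:
  "carrier (group21 G) = carrier G" "mul (group21 G) x y = x \<otimes>\<^bsub>G\<^esub> y" "star (group21 G) x = inv\<^bsub>G\<^esub> x"
  by (simp_all add: group21_def)

context group
begin

abbreviation lprod :: "'a list \<Rightarrow> 'a" where
  "lprod xs \<equiv> foldr (\<otimes>) xs \<one>"

lemma lprod_closed: "set xs \<subseteq> carrier G \<Longrightarrow> lprod xs \<in> carrier G"
  by (induction xs) auto

lemma lprod_append:
  "set xs \<subseteq> carrier G \<Longrightarrow> set ys \<subseteq> carrier G \<Longrightarrow> lprod (xs @ ys) = lprod xs \<otimes> lprod ys"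
  by (induction xs) (auto simp: lprod_closed m_assoc)

lemma inv_lprod: "set xs \<subseteq> carrier G \<Longrightarrow> lprod (map (m_inv G) xs) = inv (lprod (rev xs))"
proof (induction xs)
  case (Cons x xs)
  then have "set (rev xs) \<subseteq> carrier G" by auto
  then show ?case using Cons lprod_closed[of "rev xs"] lprod_append[of "rev xs" "[x]"]
    by (simp add: inv_mult_group)
qed simp

lemma derived_conj:
  assumes "subgroup K G" "x \<in> K" "d \<in> derived G K"
  shows "x \<otimes> d \<otimes> inv x \<in> derived G K"
proof -
  have "x \<otimes> d \<otimes> inv\<^bsub>G\<lparr>carrier := K\<rparr>\<^esub> x \<in> derived G K"
    using normal.inv_op_closed2[OF derived_subgroup_is_normal[OF assms(1)], of x d] assms by simp
  then show ?thesis using m_inv_consistent[OF assms(1,2)] by simp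
qed

lemma derived_commutator: "x \<in> K \<Longrightarrow> y \<in> K \<Longrightarrow> x \<otimes> y \<otimes> inv x \<otimes> inv y \<in> derived G K"
  unfolding derived_def by (rule generate.incl) blast

text \<open>Moving \<open>x\<close> from behind \<open>as\<close> to the front costs one commutator
  of \<open>x\<close> with the product of \<open>as\<close>; the rest is the induction hypothesis
  conjugated by \<open>x\<close>.\<close>

lemma lprod_perm_derived:
  assumes K: "subgroup K G" and "set xs \<subseteq> K" "mset ys = mset xs"
  shows "lprod xs \<otimes> inv (lprod ys) \<in> derived G K"
  using assms(2,3)
proof (induction xs arbitrary: ys)
  case Nil
  then show ?case
    using subgroup.one_closed[OF derived_is_subgroup[OF subgroup.subset[OF K]]] by simp
next
  case (Cons x xs)
  have Kc: "K \<subseteq> carrier G" using subgroup.subset[OF K] .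
  have "x \<in> set ys" using Cons.prems(2) by (metis list.set_intros(1) set_mset_mset)
  then obtain as bs where ys: "ys = as @ x # bs" by (meson split_list)
  have ms: "mset (as @ bs) = mset xs" using Cons.prems(2) ys by simp
  then have asbs: "set as \<subseteq> K" "set bs \<subseteq> K"
    using Cons.prems(1) mset_eq_setD[OF ms] by auto
  have lK: "lprod zs \<in> K" if "set zs \<subseteq> K" for zs
    using that subgroup.one_closed[OF K] subgroup.m_closed[OF K] by (induction zs) auto
  define p a b where "p = lprod xs" and "a = lprod as" and "b = lprod bs"
  have inK: "x \<in> K" "p \<in> K" "a \<in> K" "b \<in> K" using lK asbs Cons.prems(1) by (auto simp: p_def a_def b_def)
  have c: "x \<in> carrier G" "p \<in> carrier G" "a \<in> carrier G" "b \<in> carrier G"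
    using inK Kc by auto
  have cancel: "y \<otimes> (inv y \<otimes> z) = z" "inv y \<otimes> (y \<otimes> z) = z" if "y \<in> carrier G" "z \<in> carrier G" for y z
    using that by (simp_all flip: m_assoc)
  have "p \<otimes> inv (a \<otimes> b) \<in> derived G K"
    using Cons.IH[OF _ ms] Cons.prems(1) asbs Kc by (simp add: lprod_append p_def a_def b_def del: foldr_append)
  then have "(x \<otimes> (p \<otimes> inv (a \<otimes> b)) \<otimes> inv x) \<otimes> (x \<otimes> a \<otimes> inv x \<otimes> inv a) \<in> derived G K"
    using derived_conj[OF K inK(1)] derived_commutator[OF inK(1,3)]
      subgroup.m_closed[OF derived_is_subgroup[OF Kc]] by blast
  also have "(x \<otimes> (p \<otimes> inv (a \<otimes> b)) \<otimes> inv x) \<otimes> (x \<otimes> a \<otimes> inv x \<otimes> inv a) = (x \<otimes> p) \<otimes> inv (a \<otimes> (x \<otimes> b))"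
    using c by (simp add: m_assoc inv_mult_group cancel)
  finally show ?case
    using ys asbs Kc c by (simp add: lprod_append p_def a_def b_def del: foldr_append)
qed

lemma eval21_prod21:
  assumes "\<And>q. eval21 (group21 G) a (f q) \<in> carrier G"
  shows "eval21 (group21 G) a (prod21 f j) = lprod (map (\<lambda>q. eval21 (group21 G) a (f q)) [0..<Suc j])"
proof (induction j)
  case (Suc j)
  have "lprod (map (\<lambda>q. eval21 (group21 G) a (f q)) ([0..<Suc j] @ [Suc j])) =
    lprod (map (\<lambda>q. eval21 (group21 G) a (f q)) [0..<Suc j]) \<otimes> eval21 (group21 G) a (f (Suc j))"
    unfolding map_append using assms by (subst lprod_append) auto
  then show ?case using Suc by simp
qed (simp add: assms)

text \<open>By \<open>perm\<close> the negative half inverts the values of the positive half in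
  another order, so each level descends by one derived subgroup.\<close>

lemma word21_derived:
  assumes n: "0 < n" and perm: "mset (map child [0..<n]) = mset (map child [n..<2 * n])"
    and a: "range a \<subseteq> carrier G"
  shows "eval21 (group21 G) a (word21 (2 * n) (\<lambda>q. q < n) child l r) \<in> (derived G ^^ l) (carrier G)"
proof (induction l arbitrary: r)
  case 0
  then show ?case using a by auto
next
  case (Suc l)
  define K where "K = (derived G ^^ l) (carrier G)"
  have K: "subgroup K G" unfolding K_def by (rule exp_of_derived_is_subgroup[OF subgroup_self])
  define w where "w i = word21 (2 * n) (\<lambda>q. q < n) child l (\<lambda>\<alpha>. r (i # \<alpha>))" for i
  define c where "c i = eval21 (group21 G) a (w i)" for i
  have cK: "c i \<in> K" for i using Suc by (simp add: c_def w_def K_def)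
  then have cG: "c i \<in> carrier G" for i using subgroup.subset[OF K] by blast
  define f where "f q = (if q < n then w (child q) else Star (w (child q)))" for q
  have ev: "eval21 (group21 G) a (f q) = (if q < n then c (child q) else inv (c (child q)))" for q
    by (simp add: f_def c_def)
  define xs where "xs = map (\<lambda>q. c (child q)) [0..<n]"
  define ys where "ys = map (\<lambda>q. c (child q)) [n..<2 * n]"
  have carr: "set xs \<subseteq> carrier G" "set ys \<subseteq> carrier G" "set xs \<subseteq> K"
    using cG cK by (auto simp: xs_def ys_def)
  have "word21 (2 * n) (\<lambda>q. q < n) child (Suc l) r = prod21 f (2 * n - 1)"
    unfolding word21.simps Let_def f_def w_def ..
  then have "eval21 (group21 G) a (word21 (2 * n) (\<lambda>q. q < n) child (Suc l) r) =
      lprod (map (\<lambda>q. eval21 (group21 G) a (f q)) [0..<Suc (2 * n - 1)])"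
    using cG by (simp only:) (rule eval21_prod21, simp add: ev)
  also have "[0..<Suc (2 * n - 1)] = [0..<n] @ [n..<2 * n]"
    using n upt_add_eq_append[of 0 n n] by (simp add: mult_2)
  also have "map (\<lambda>q. eval21 (group21 G) a (f q)) ([0..<n] @ [n..<2 * n]) = xs @ map (m_inv G) ys"
    by (simp add: ev xs_def ys_def)
  also have "lprod (xs @ map (m_inv G) ys) = lprod xs \<otimes> inv (lprod (rev ys))"
    using carr by (subst lprod_append) (auto simp: inv_lprod)
  also have "\<dots> \<in> derived G K"
  proof (rule lprod_perm_derived[OF K carr(3)])
    have "mset (map c (map child [0..<n])) = mset (map c (map child [n..<2 * n]))"
      using perm by (simp only: mset_map[of c])
    then show "mset (rev ys) = mset xs" by (simp add: xs_def ys_def comp_def)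
  qed
  finally show ?case by (simp add: K_def)
qed

section \<open>From group laws to identities of the power semigroup\<close>

lemma eval21_in_Pow21:
  assumes "\<And>i. i \<in> vars21 t \<Longrightarrow> a i \<in> A i"
  shows "eval21 (group21 G) a t \<in> eval21 (Pow21 G) A t"
  using assms by (induction t) (auto simp: set_mult_def SET_INV_def)

lemma eval21_Pow21_empty: "i \<in> vars21 t \<Longrightarrow> A i = {} \<Longrightarrow> eval21 (Pow21 G) A t = {}"
  by (induction t) (auto simp: set_mult_def SET_INV_def)

lemma one_in_eval_law:
  assumes "\<And>a. range a \<subseteq> carrier G \<Longrightarrow> eval21 (group21 G) a t = \<one>"
    and A: "range A \<subseteq> Pow (carrier G)" and ne: "eval21 (Pow21 G) A t \<noteq> {}"
  shows "\<one> \<in> eval21 (Pow21 G) A t"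
proof -
  \<comment> \<open>The default \<open>\<one>\<close> never matters for variables of
    \<open>t\<close>: an empty value there would make the value of \<open>t\<close> empty.\<close>
  define a where "a i = (if A i = {} then \<one> else (SOME x. x \<in> A i))" for i
  have aA: "a i \<in> A i" if "A i \<noteq> {}" for i
    using that some_in_eq by (auto simp: a_def)
  then have "a i \<in> carrier G" for i using A by (cases "A i = {}") (auto simp: a_def)
  then have "eval21 (group21 G) a t = \<one>" using assms(1) by auto
  moreover have "a i \<in> A i" if "i \<in> vars21 t" for i
    using aA that ne eval21_Pow21_empty by metis
  ultimately show ?thesis using eval21_in_Pow21 by metis
qed

text \<open>If \<open>card (P (j + 1)) = card (P j)\<close>, then \<open>P (j + 1)\<close> is a right translate of \<open>P j\<close>, and left
  multiplication by \<open>X\<close> passes this on to \<open>j + 1\<close>.\<close>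

lemma set_power_stable:
  assumes fin: "finite (carrier G)" and X: "X \<subseteq> carrier G" "X \<noteq> {}"
    and P: "P 0 = X" "\<And>j. P (Suc j) = P j <#> X"
  shows "card (P (Suc (card (carrier G)))) = card (P (card (carrier G)))"
proof (rule ccontr)
  assume neq: "\<not> ?thesis"
  have PG: "P j \<subseteq> carrier G" for j
    using X(1) set_mult_closed by (induction j) (auto simp: P)
  have left: "P (Suc j) = X <#> P j" for j
    using X(1) PG by (induction j) (simp_all add: P set_mult_assoc)
  have mono: "card (P j) \<le> card (P (Suc j))" for j
    using card_set_mult_left[OF fin PG X] by (simp add: P)
  obtain x where x: "x \<in> X" "x \<in> carrier G" using X by blast
  have stable: "card (P (Suc (Suc j))) = card (P (Suc j))" if "card (P (Suc j)) = card (P j)" for j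
  proof -
    have "P j #> x \<subseteq> P (Suc j)" using x by (auto simp: P r_coset_def set_mult_def)
    moreover have "card (P j #> x) = card (P (Suc j))" using that card_r_coset PG x by simp
    ultimately have "P j #> x = P (Suc j)" using card_subset_eq finite_subset[OF PG fin] by blast
    then have "P (Suc (Suc j)) = X <#> (P j <#> {x})" by (simp add: left r_coset_eq_set_mult)
    also have "\<dots> = P (Suc j) #> x" using X(1) PG x by (simp add: left set_mult_assoc r_coset_eq_set_mult)
    finally show ?thesis using card_r_coset PG x by simp
  qed
  \<comment> \<open>Induction downwards from \<open>card (carrier G)\<close>, where
    \<open>neq\<close> gives strictness; by \<open>stable\<close>, equality at \<open>j\<close>
    would pass to \<open>Suc j\<close>.\<close>
  have strict: "card (P j) < card (P (Suc j))" if "j \<le> card (carrier G)" for j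
    using that
  proof (induction "card (carrier G) - j" arbitrary: j)
    case 0
    then show ?case using neq mono[of j] by (simp add: le_antisym)
  next
    case (Suc d)
    then have "card (P (Suc j)) < card (P (Suc (Suc j)))" by simp
    then show ?case using stable[of j] mono[of j] by linarith
  qed
  have "j < card (P (Suc j))" if "j \<le> card (carrier G)" for j
    using that
  proof (induction j)
    case 0
    then show ?case using strict[of 0] by simp
  next
    case (Suc j)
    then show ?case using strict[of "Suc j"] by simp
  qed
  then have "card (carrier G) < card (P (Suc (card (carrier G))))" by blast
  then show False using card_mono[OF fin PG] by (simp add: leD)
qed

lemma power_law:
  assumes fin: "finite (carrier G)"
    and law: "\<And>a. range a \<subseteq> carrier G \<Longrightarrow> eval21 (group21 G) a w = \<one>"
  shows "satisfies (Pow21 G)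
    (Mul (prod21 (\<lambda>_. Mul w (Var i)) (card (carrier G))) w, prod21 (\<lambda>_. Mul w (Var i)) (card (carrier G)))"
  unfolding satisfies_def fst_conv snd_conv
proof (intro allI impI)
  fix A :: "nat \<Rightarrow> 'a set" assume A: "range A \<subseteq> carrier (Pow21 G)"
  define V where "V = eval21 (Pow21 G) A w"
  define P where "P j = eval21 (Pow21 G) A (prod21 (\<lambda>_. Mul w (Var i)) j)" for j
  have cl: "eval21 (Pow21 G) A t \<subseteq> carrier G" for t
    using eval21_closed[OF algebra21_Pow21 A] by simp
  have P: "P 0 = V <#> A i" "P (Suc j) = P j <#> (V <#> A i)" for j
    by (simp_all add: P_def V_def)
  let ?m = "card (carrier G)"
  have VA: "V \<subseteq> carrier G" "A i \<subseteq> carrier G" "P j \<subseteq> carrier G" for j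
    using cl[of w] cl[of "Var i"] cl unfolding V_def P_def by simp_all
  have "P ?m <#> V = P ?m"
  proof (cases "V <#> A i = {}")
    case True
    then have "P j = {}" for j by (cases j) (simp_all add: P set_mult_def)
    then show ?thesis by (simp add: set_mult_def)
  next
    case False
    then have ne: "V \<noteq> {}" "A i \<noteq> {}" by (auto simp: set_mult_def)
    have "\<one> \<in> V" using one_in_eval_law[of w A] law A ne(1) by (simp add: V_def)
    then have sub: "P ?m \<subseteq> P ?m <#> V"
      using VA(3)[of ?m] r_one unfolding set_mult_def by force
    have cl': "P ?m <#> V \<subseteq> carrier G" by (rule set_mult_closed[OF VA(3,1)])
    \<comment> \<open>Multiplying by \<open>A i\<close> completes the next power, whose size is that
      of \<open>P ?m\<close>; this turns the inclusion \<open>sub\<close> into an equality.\<close>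
    have "card (P ?m <#> V) \<le> card (P ?m <#> V <#> A i)"
      using card_set_mult_left[OF fin cl' VA(2) ne(2)] .
    also have "P ?m <#> V <#> A i = P (Suc ?m)" using VA by (simp add: P set_mult_assoc)
    also have "card (P (Suc ?m)) = card (P ?m)"
      using set_power_stable[of "V <#> A i" P] fin VA P False set_mult_closed by blast
    finally show ?thesis using sub card_seteq[OF finite_subset[OF cl' fin] sub] by simp
  qed
  then show "eval21 (Pow21 G) A (Mul (prod21 (\<lambda>_. Mul w (Var i)) ?m) w) =
      eval21 (Pow21 G) A (prod21 (\<lambda>_. Mul w (Var i)) ?m)"
    by (simp add: P_def V_def)
qed

end

context block_sequence
begin

text \<open>The map \<open>E\<close> places a block in the surrounding word and is kept general for
  the induction. At an inverted place it runs backwards, and the converse taken by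
  \<open>Star\<close> restores the direction.\<close>

lemma word21_path:
  assumes "\<And>\<alpha> x y. length \<alpha> = l \<Longrightarrow> (x, y) \<in> jump l \<alpha> 0 1 \<Longrightarrow> (E x, E y) \<in> v (r \<alpha>)"
  shows "(E 0, E (M ^ l)) \<in> eval21 (rel_algebra C) v (word21 M pos child l r)"
  using assms
proof (induction l arbitrary: E r)
  case 0
  then show ?case by simp
next
  case (Suc l)
  define f where "f q = (let w = word21 M pos child l (\<lambda>\<alpha>. r (child q # \<alpha>)) in if pos q then w else Star w)" for q
  have step: "(E (q * M ^ l), E ((q + 1) * M ^ l)) \<in> eval21 (rel_algebra C) v (f q)" if q: "q < M" for q
  proof -
    have "(E (cp (M ^ l) q 0), E (cp (M ^ l) q (M ^ l))) \<in>
        eval21 (rel_algebra C) v (word21 M pos child l (\<lambda>\<alpha>. r (child q # \<alpha>)))"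
    proof (rule Suc.IH)
      fix \<alpha> x y assume "length \<alpha> = l" "(x, y) \<in> jump l \<alpha> 0 1"
      then show "(E (cp (M ^ l) q x), E (cp (M ^ l) q y)) \<in> v (r (child q # \<alpha>))"
        using q by (intro Suc.prems) (auto simp: lift_def)
    qed
    then show ?thesis by (cases "pos q") (simp_all add: f_def emb_def Let_def add.commute)
  qed
  have "(E 0, E ((j + 1) * M ^ l)) \<in> eval21 (rel_algebra C) v (prod21 f j)" if "j < M" for j
    using that
  proof (induction j)
    case 0
    then show ?case using step[of 0] by simp
  next
    case (Suc j)
    then show ?case using step[of "Suc j"] by auto
  qed
  from this[of "M - 1"] show ?case using M_pos by (simp add: f_def[abs_def])
qed

lemma Jumps_violates_law:
  fixes l m :: nat
  defines "w \<equiv> word21 M pos child l to_nat" and "i \<equiv> to_nat (replicate (Suc l) (0::nat))"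
  shows "\<not> satisfies (rel_algebra (Jumps l)) (Mul (prod21 (\<lambda>_. Mul w (Var i)) m) w, prod21 (\<lambda>_. Mul w (Var i)) m)"
proof
  \<comment> \<open>Letters of \<open>w\<close> code addresses of length \<open>l\<close>. Every
    other variable, in particular \<open>i\<close>, which codes a longer list, jumps from the end of
    the word to its start.\<close>
  define v where "v j = (let \<alpha> = from_nat j :: nat list in
    if length \<alpha> = l then jump l \<alpha> 0 1 else {(M ^ l, 0)})" for j :: nat
  let ?u = "prod21 (\<lambda>_. Mul w (Var i)) m" and ?ev = "eval21 (rel_algebra (Jumps l)) v"
  assume sat: "satisfies (rel_algebra (Jumps l)) (Mul ?u w, ?u)"
  have "v j \<in> Jumps l" for j
  proof (cases "length (from_nat j :: nat list) = l")
    case True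
    then show ?thesis unfolding Jumps_def v_def Let_def
      by (intro insertI2 CollectI exI[of _ "from_nat j"] exI[of _ 0] exI[of _ 1]) simp
  next
    case False
    then show ?thesis using singleton_in_Jumps[of "M ^ l" l 0] by (simp add: v_def)
  qed
  then have "range v \<subseteq> carrier (rel_algebra (Jumps l))" by auto
  then have eq: "?ev (Mul ?u w) = ?ev ?u"
    using sat unfolding satisfies_def fst_conv snd_conv by blast
  have w: "(0, M ^ l) \<in> ?ev w"
    unfolding w_def using word21_path[of l "\<lambda>x. x" v to_nat "Jumps l"] by (simp add: v_def)
  have vi: "v i = {(M ^ l, 0)}" by (simp add: v_def i_def)
  have "(0, 0) \<in> ?ev (prod21 (\<lambda>_. Mul w (Var i)) j)" for j
    using w vi by (induction j) auto
  then have "(0, M ^ l) \<in> ?ev ?u" using w eq by auto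
  \<comment> \<open>The last factor is always \<open>Var i\<close>, whose value has range
    \<open>{0}\<close>.\<close>
  moreover have "y = 0" if "(x, y) \<in> ?ev (prod21 (\<lambda>_. Mul w (Var i)) j)" for x y j
    using that vi by (cases j) auto
  ultimately show False using M_pos by fastforce
qed

end

section \<open>Arranging the blocks by rows and columns\<close>

text \<open>With the \<open>m\<^sup>2\<close> blocks arranged in a square, the positive half reads the square by rows and the
  negative half by columns.\<close>

definition flip :: "nat \<Rightarrow> nat \<Rightarrow> nat" where
  "flip m j = (j mod m) * m + j div m"

lemma flip_less: "j < m * m \<Longrightarrow> flip m j < m * m"
proof -
  assume j: "j < m * m"
  then have m: "0 < m" by (cases m) auto
  have "j mod m \<le> m - 1" "j div m < m" using m j by (auto simp: less_mult_imp_div_less Suc_leI simp flip: less_Suc_eq_le)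
  then have "(j mod m) * m + j div m < (m - 1) * m + m" by (meson add_le_less_mono mult_le_mono1)
  then show ?thesis using m by (simp add: flip_def diff_mult_distrib)
qed

lemma flip_pair: "b < m \<Longrightarrow> flip m (a * m + b) = b * m + a"
  by (simp add: flip_def)

lemma square_pair:
  assumes "j < m * m"
  obtains a b where "j = a * m + b" "a < m" "b < (m :: nat)"
proof
  show "j = (j div m) * m + j mod m" by simp
  show "j div m < m" using assms by (simp add: less_mult_imp_div_less)
  show "j mod m < m" using assms by (cases m) auto
qed

lemma flip_flip: "j < m * m \<Longrightarrow> flip m (flip m j) = j"
  by (elim square_pair) (simp add: flip_pair)

lemma small_multiple: "\<bar>z * w\<bar> < w \<Longrightarrow> z = 0" for z w :: int
proof (rule ccontr)
  assume "\<bar>z * w\<bar> < w" "z \<noteq> 0"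
  then have "1 * \<bar>w\<bar> \<le> \<bar>z\<bar> * \<bar>w\<bar>" by (intro mult_right_mono) auto
  moreover have "0 < w" using \<open>\<bar>z * w\<bar> < w\<close> abs_ge_zero le_less_trans by blast
  ultimately show False using \<open>\<bar>z * w\<bar> < w\<close> by (simp add: abs_mult)
qed

text \<open>For \<open>x = a - c\<close> and \<open>y = b - d\<close>, both \<open>x * m + y\<close>
  and \<open>y * m + x\<close> are at most \<open>2 * k\<close> in absolute value. Their sum
  \<open>(x + y) * (m + 1)\<close> and difference \<open>(x - y) * (m - 1)\<close> are then at most
  \<open>4 * k = m - 2\<close>, so both vanish.\<close>

lemma rows_columns_far:
  fixes a b c d k :: nat
  assumes m: "m = 4 * k + 2" and lt: "a < m" "b < m" "c < m" "d < m"
    and "a * m + b \<le> c * m + d + 2 * k" "c * m + d \<le> a * m + b + 2 * k"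
    and "b * m + a \<le> d * m + c + 2 * k" "d * m + c \<le> b * m + a + 2 * k"
  shows "a = c \<and> b = d"
proof -
  define x y where "x = int a - int c" and "y = int b - int d"
  have ineqs: "x * int m + y \<le> 2 * int k" "- (x * int m + y) \<le> 2 * int k"
     "y * int m + x \<le> 2 * int k" "- (y * int m + x) \<le> 2 * int k"
    using assms(6-9)[THEN of_nat_mono[where 'a = int]] by (simp_all add: x_def y_def algebra_simps)
  have m': "int m = 4 * int k + 2" using m by simp
  have "(x + y) * (int m + 1) = (x * int m + y) + (y * int m + x)" by (simp add: algebra_simps)
  then have "\<bar>(x + y) * (int m + 1)\<bar> < int m + 1" using ineqs m' by linarith
  moreover have "(x - y) * (int m - 1) = (x * int m + y) - (y * int m + x)" by (simp add: algebra_simps)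
  then have "\<bar>(x - y) * (int m - 1)\<bar> < int m - 1" using ineqs m' by linarith
  ultimately have "x + y = 0" "x - y = 0" using small_multiple by blast+
  then show ?thesis by (simp add: x_def y_def)
qed

text \<open>Concerns places close to each other across the middle of the word. The hypothesis forces
  \<open>b\<close> to be at least \<open>m - 2 * k\<close>, so \<open>m * m + (b * m + a)\<close>
  lies at least \<open>m > 2 * k\<close> behind the middle, while \<open>c * m + d\<close> lies
  before it.\<close>

lemma halves_far:
  fixes a b c d k :: nat
  assumes m: "m = 4 * k + 2" and lt: "a < m" "b < m" "c < m" "d < m"
    and le: "m * m + (d * m + c) \<le> a * m + b + 2 * k"
  shows "c * m + d + 2 * k < m * m + (b * m + a)"
proof -
  have "(a + 1) * m \<le> m * m" "(c + 1) * m \<le> m * m" using lt by (intro mult_le_mono1, simp)+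
  moreover have "b \<le> b * m" "d \<le> d * m" using m by simp_all
  ultimately show ?thesis using le m by (simp add: algebra_simps)
qed

lemma block_sequence_flip:
  fixes k m n :: nat and child twin :: "nat \<Rightarrow> nat"
  assumes k: "0 < k" and m: "m = 4 * k + 2" and n: "n = m * m"
    and child: "\<And>q. child q = (if q < n then q else flip m (q - n))"
    and twin: "\<And>q. twin q = (if q < n then n + flip m q else flip m (q - n))"
  shows "block_sequence (2 * n) k child twin"
proof -
  have half: "child q < n \<and> (q = child q \<and> twin q = n + flip m (child q) \<or> q = n + flip m (child q) \<and> twin q = child q)"
    if "q < 2 * n" for q
  proof (cases "q < n")
    case False
    then have "q - n < m * m" using that n by simp
    then show ?thesis using flip_less[of "q - n" m] flip_flip[of "q - n" m] False n by (simp add: child twin)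
  qed (simp add: child twin)
  have pair: "\<exists>a b. a < m \<and> b < m \<and> child q = a * m + b \<and>
      (q = a * m + b \<and> twin q = n + (b * m + a) \<or> q = n + (b * m + a) \<and> twin q = a * m + b)"
    if "q < 2 * n" for q
  proof -
    have "child q < m * m" using half[OF that] n by simp
    then obtain a b where ab: "child q = a * m + b" "a < m" "b < m" by (rule square_pair)
    then have "flip m (child q) = b * m + a" by (simp add: flip_pair)
    then show ?thesis using half[OF that] ab by metis
  qed
  show ?thesis
  proof
    show "0 < 2 * n" "0 < k" using k m n by simp_all
  next
    fix q assume q: "q < 2 * n"
    have fl: "flip m (child q) < n" "flip m (flip m (child q)) = child q"
      using half[OF q] flip_less flip_flip n by simp_all
    show "twin q < 2 * n" "child (twin q) = child q"
      using half[OF q] fl by (auto simp: child[of "twin q"])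
    show "twin (twin q) = q"
      using half[OF q] fl by (auto simp: twin[of "twin q"])
    obtain a b where ab: "a < m" "b < m"
      "q = a * m + b \<and> twin q = n + (b * m + a) \<or> q = n + (b * m + a) \<and> twin q = a * m + b"
      using pair[OF q] by blast
    have "(a + 1) * m \<le> m * m" using ab by (intro mult_le_mono1) simp
    then have "a * m + m \<le> n" by (simp add: n)
    moreover have "b \<le> b * m" by (simp add: m)
    ultimately have "a * m + b + 2 * k < n + (b * m + a)" using m by linarith
    then show "q + 2 * k < twin q \<or> twin q + 2 * k < q" using ab(3) by linarith
  next
    fix q r assume "q < 2 * n" "r < 2 * n" "child q = child r"
    then show "r = q \<or> r = twin q" using half[of q] half[of r] by metis
  next
    fix q r
    assume q: "q < 2 * n" and r: "r < 2 * n" and ne: "child q \<noteq> child r"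
      and near: "q \<le> r + 2 * k" "r \<le> q + 2 * k"
    obtain a b where ab: "a < m" "b < m" "child q = a * m + b"
      "q = a * m + b \<and> twin q = n + (b * m + a) \<or> q = n + (b * m + a) \<and> twin q = a * m + b"
      using pair[OF q] by blast
    obtain c d where cd: "c < m" "d < m" "child r = c * m + d"
      "r = c * m + d \<and> twin r = n + (d * m + c) \<or> r = n + (d * m + c) \<and> twin r = c * m + d"
      using pair[OF r] by blast
    \<comment> \<open>This settles two places in the same half; \<open>h1\<close> and
      \<open>h2\<close> settle places in opposite halves.\<close>
    have rc: "\<not> (a * m + b \<le> c * m + d + 2 * k \<and> c * m + d \<le> a * m + b + 2 * k \<and>
        b * m + a \<le> d * m + c + 2 * k \<and> d * m + c \<le> b * m + a + 2 * k)"
      using rows_columns_far[OF m ab(1,2) cd(1,2)] ne ab(3) cd(3) by metis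
    have h1: "c * m + d + 2 * k < n + (b * m + a)" if "n + (d * m + c) \<le> a * m + b + 2 * k"
      using halves_far[OF m ab(1,2) cd(1,2)] that n by blast
    have h2: "a * m + b + 2 * k < n + (d * m + c)" if "n + (b * m + a) \<le> c * m + d + 2 * k"
      using halves_far[OF m cd(1,2) ab(1,2)] that n by blast
    show "twin q + 2 * k < twin r \<or> twin r + 2 * k < twin q"
      using ab(4) cd(4) near rc h1 h2 by linarith
  qed
qed

lemma mset_flip: "mset (map (flip m) [0..<m * m]) = mset [0..<m * m]"
proof -
  have "inj_on (flip m) {0..<m * m}" by (rule inj_on_inverseI[of _ "flip m"]) (simp add: flip_flip)
  moreover have "flip m ` {0..<m * m} = {0..<m * m}"
  proof
    show "flip m ` {0..<m * m} \<subseteq> {0..<m * m}" using flip_less by auto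
    show "{0..<m * m} \<subseteq> flip m ` {0..<m * m}"
      using flip_flip flip_less by (metis atLeastLessThan_iff image_eqI subsetI zero_le)
  qed
  ultimately show ?thesis by (simp add: image_mset_mset_set)
qed

theorem theorem1p3:
  fixes G :: "('a, 'b) monoid_scheme"
  assumes "group G"
    and "finite (carrier G)"
    and "solvable G"
    and "\<not> Dedekind_group G"
  shows "\<not> finitely_based (power_involution_semigroup G)"
proof
  interpret group G by fact
  assume "finitely_based (Pow21 G)"
  then obtain \<Sigma> where fin: "finite \<Sigma>" and basis: "identity_basis (Pow21 G) \<Sigma>"
    by (auto simp: finitely_based_def)
  have "finite (\<Union>e\<in>\<Sigma>. vars21 (fst e) \<union> vars21 (snd e))"
    using fin finite_vars21 by blast
  then obtain k0 where "(\<Union>e\<in>\<Sigma>. vars21 (fst e) \<union> vars21 (snd e)) \<subseteq> {..<k0}"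
    by (metis finite_nat_iff_bounded)
  then have vars: "vars21 (fst e) \<subseteq> {..<Suc k0}" "vars21 (snd e) \<subseteq> {..<Suc k0}" if "e \<in> \<Sigma>" for e
    using that by fastforce+
  obtain h where h: "(derived G ^^ h) (carrier G) = {\<one>\<^bsub>G\<^esub>}"
    using assms(3) solvable_iff_trivial_derived_seq by blast
  obtain H g where Hg: "subgroup H G" "g \<in> carrier G" "\<exists>x\<in>H. g \<otimes>\<^bsub>G\<^esub> x \<otimes>\<^bsub>G\<^esub> inv\<^bsub>G\<^esub> g \<notin> H"
    using assms(1,4) normal_inv_iff unfolding Dedekind_group_def by metis
  interpret non_normal G H g
    by (intro non_normal.intro non_normal_axioms.intro assms(1,2) Hg)
  \<comment> \<open>Bounds the variables of the basis and is positive, as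
    \<open>block_sequence\<close> demands.\<close>
  define k where "k = Suc k0"
  define m where "m = 4 * k + 2"
  define n where "n = m * m"
  define child where "child q = (if q < n then q else flip m (q - n))" for q
  define twin where "twin q = (if q < n then n + flip m q else flip m (q - n))" for q
  interpret block_sequence "2 * n" k "\<lambda>q. q < n" child twin
    by (rule block_sequence_flip[OF _ m_def n_def child_def twin_def]) (simp add: k_def)
  \<comment> \<open>Nesting \<open>h\<close> times pushes the values of \<open>w\<close> in
    \<open>G\<close> into the trivial subgroup.\<close>
  define w where "w = word21 (2 * n) (\<lambda>q. q < n) child h to_nat"
  define i where "i = to_nat (replicate (Suc h) (0::nat))"
  define e where "e = (Mul (prod21 (\<lambda>_. Mul w (Var i)) (card (carrier G))) w,
    prod21 (\<lambda>_. Mul w (Var i)) (card (carrier G)))"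
  have n: "0 < n" by (simp add: n_def m_def)
  have "map child [0..<n] = [0..<n]" by (rule map_idI) (simp add: child_def)
  moreover have "map child [n..<2 * n] = map (flip m) [0..<n]"
    by (rule nth_equalityI) (simp_all add: child_def)
  ultimately have "mset (map child [0..<n]) = mset (map child [n..<2 * n])"
    using mset_flip[of m] by (simp only: n_def)
  then have "eval21 (group21 G) a w = \<one>\<^bsub>G\<^esub>" if "range a \<subseteq> carrier G" for a
    using word21_derived[OF n _ that, of child h to_nat] h by (simp add: w_def)
  then have "e \<in> identities (Pow21 G)"
    using power_law[OF assms(2)] by (simp add: identities_def e_def)
  moreover have "satisfies (rel_algebra (Jumps h)) e'" if "e' \<in> \<Sigma>" for e'
  proof (rule satisfies_Jumps)
    have "satisfies (Pow21 G) e'"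
      using basis that by (auto simp: identity_basis_def identity_basis_over_def identities_def)
    then show "satisfies (rel_algebra B21) e'" by (rule satisfies_B21)
  qed (use vars[OF that] in \<open>simp_all add: k_def\<close>)
  \<comment> \<open>The basis is given for algebras over \<open>nat\<close>;
    \<open>identity_basis_imp\<close> carries it over to algebras of relations on
    \<open>nat\<close>.\<close>
  ultimately have "satisfies (rel_algebra (Jumps h)) e"
    using identity_basis_imp[OF basis] algebra21_Jumps unfolding identity_basis_over_def by blast
  then show False
    using Jumps_violates_law[of h "card (carrier G)"] n by (simp add: e_def w_def i_def)
qed

end
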